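(* For each centrally symmetric convex body $K\subset\mathbb{R}^2$ we have $$\delta_L(K)\geq\frac{1}{2\pi\sqrt{3}}\,|K|\,|K^{\circ}|,$$ with equality if and only if $K$ is an ellipse.
   Context: A convex body in $\mathbb{R}^n$ is a convex compact set with non-empty interior; $|K|$ denotes its volume (area when $n=2$). $K$ is centrally symmetric if $K=-K$. If $0\in\operatorname{int}K$, the polar body is $K^{\circ}:=\{x\in\mathbb{R}^n\mid \langle y,x\rangle\leq 1 \text{ for all } y\in K\}$. A lattice in $\mathbb{R}^n$ is a set $\Lambda=A\mathbb{Z}^n$ with $A\in GL(n,\mathbb{R})$, and $d(\Lambda):=|\det A|$. $\delta_L(K)$ denotes the density of the densest lattice packing in $\mathbb{R}^n$ by translates of $K$, i.e. the maximum of $|K|/d(\Lambda)$ over lattices $\Lambda$ such that the translates $x+K$, $x\in\Lambda$, have pairwise disjoint interiors. "Ellipse" means the closed region bounded by an ellipse (discs included). *)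

theory Defs
  imports "HOL-Analysis.Analysis"
begin

definition convex_body :: "(real ^ 'n) set \<Rightarrow> bool" where
  "convex_body K \<longleftrightarrow> convex K \<and> compact K \<and> interior K \<noteq> {}"

definition centrally_symmetric :: "(real ^ 'n) set \<Rightarrow> bool" where
  "centrally_symmetric K \<longleftrightarrow> K = uminus ` K"

definition polar_body :: "(real ^ 'n) set \<Rightarrow> (real ^ 'n) set" where
  "polar_body K = {x. \<forall>y\<in>K. y \<bullet> x \<le> 1}"

definition lattice_of :: "real ^ 'n ^ 'n \<Rightarrow> (real ^ 'n) set" where
  "lattice_of A = (\<lambda>z. A *v z) ` {z. \<forall>i. z $ i \<in> \<int>}"

definition is_packing :: "(real ^ 'n) set \<Rightarrow> (real ^ 'n) set \<Rightarrow> bool" where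
  "is_packing L K \<longleftrightarrow>
     (\<forall>x\<in>L. \<forall>y\<in>L. x \<noteq> y \<longrightarrow> interior ((+) x ` K) \<inter> interior ((+) y ` K) = {})"

text \<open>Lattices are ranged over through their basis matrices, so that the determinant of
  the lattice is read off as \<open>\<bar>det A\<bar>\<close>. The density of a densest lattice packing is a genuine
  maximum; for a convex body it exists, so \<open>GREATEST\<close> denotes it.\<close>

definition lattice_packing_density :: "(real ^ 'n) set \<Rightarrow> real" where
  "lattice_packing_density K =
     (GREATEST r. \<exists>A :: real ^ 'n ^ 'n. invertible A \<and> is_packing (lattice_of A) K \<and>
        r = measure lebesgue K / \<bar>det A\<bar>)"

text \<open>A (filled) ellipse is a nondegenerate affine image of the closed unit disc, with
  arbitrary centre.\<close>

definition is_ellipse :: "(real ^ 2) set \<Rightarrow> bool" where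
  "is_ellipse E \<longleftrightarrow>
     (\<exists>(A :: real ^ 2 ^ 2) c. invertible A \<and> E = (\<lambda>x. c + A *v x) ` cball 0 1)"

end

theory Submission
  imports Defs
begin

text \<open>Let \<open>L\<close> be the polar body of \<open>K\<close>. A symmetric hexagon with vertices \<open>\<plusminus>a, \<plusminus>b, \<plusminus>c\<close> inscribed in \<open>L\<close>
has a polar hexagon that contains \<open>K\<close> and tiles the plane by a lattice, so the area of this polar
hexagon is the determinant of a packing lattice of \<open>K\<close>. The product of the areas of a symmetric
hexagon and its polar is at most \<open>9\<close>; in terms of \<open>p = det(a,b)\<close>, \<open>q = det(b,c)\<close>, \<open>r = det(a,c)\<close> this
is Schur's inequality, with equality only for \<open>p = q = r\<close> (lemmas \<open>schur_inequality\<close>,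
\<open>hexagon_packing\<close>). A hexagon of area \<open>S\<close> in \<open>L\<close> therefore gives density at least \<open>|K| S / 9\<close>
(\<open>packing_from_heavy_hexagon\<close>), and it remains to find hexagons with \<open>S \<ge> 3 \<surd>3 |L| / (2 \<pi>)\<close>.

These come from averaging, as in Sas's theorem on inscribed polygons. Let \<open>2 w\<close> be the width
of \<open>L\<close> in the direction of the first axis, let \<open>f\<close> be the concave function whose graph is the upper
boundary of \<open>L\<close>, and put \<open>P(\<theta>) = (w cos \<theta>, f(w cos \<theta>))\<close>. For \<open>0 < \<theta> < \<pi>/3\<close> the hexagon with
vertices \<open>\<plusminus>P(\<theta>)\<close>, \<open>\<plusminus>P(\<theta> + \<pi>/3)\<close>, \<open>\<plusminus>P(\<theta> + 2\<pi>/3)\<close> has the area \<open>\<surd>3\<close> times the sum of the values of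
\<open>w sin t f(w cos t)\<close> at these three angles, so its integral over \<open>\<theta>\<close> is
\<open>\<surd>3 \<integral> f = \<surd>3 |L| / 2\<close>, and the mean is exactly the required area
(\<open>hexagon_area_integral\<close>, \<open>hexagon_area_dichotomy\<close>).

If equality holds, no three points of \<open>L\<close> give more than the mean, so all these hexagons are extremal
and balanced (\<open>p = q = r\<close>). Balance determines \<open>f(w cos t)\<close> as \<open>k sin t + h cos t\<close>, where \<open>h\<close> depends
on \<open>t\<close> only modulo \<open>\<pi>/3\<close>; maximality under variation of one vertex makes the increments of \<open>h\<close>
quadratically small, hence \<open>h\<close> is constant (\<open>shear_increment\<close>, \<open>upper_elliptic\<close>). So \<open>L\<close>, and with it
\<open>K\<close>, is an ellipse.

For an ellipse, reduction of lattice bases shows that no lattice beats the hexagonal one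
(\<open>ellipse_density_le\<close>). The same reduction keeps the relevant bases in a compact set, which shows that
a densest lattice packing exists (\<open>minimal_packing_lattice_exists\<close>); only then does the greatest
element in the definition of the density have its intended value.\<close>

section \<open>Lattice packings and difference vectors\<close>

definition interior_differences :: "(real ^ 'n) set \<Rightarrow> (real ^ 'n) set" where
  "interior_differences K = {x - y | x y. x \<in> interior K \<and> y \<in> interior K}"

lemma open_interior_differences: "open (interior_differences K)"
proof -
  have eq: "interior_differences K = (\<Union>y\<in>interior K. (\<lambda>x. x - y) ` interior K)"
    unfolding interior_differences_def by auto
  show ?thesis
    unfolding eq using open_translation_subtract[OF open_interior] by auto
qed

lemma lattice_of_diff:
  assumes "x \<in> lattice_of A" "y \<in> lattice_of A"
  shows "x - y \<in> lattice_of A"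
proof -
  obtain u v where "x = A *v u" "\<forall>i. u $ i \<in> \<int>" "y = A *v v" "\<forall>i. v $ i \<in> \<int>"
    using assms unfolding lattice_of_def by auto
  then have "x - y = A *v (u - v)" "\<forall>i. (u - v) $ i \<in> \<int>"
    by (auto simp: matrix_vector_mult_diff_distrib)
  then show ?thesis unfolding lattice_of_def by blast
qed

lemma zero_in_lattice_of: "0 \<in> lattice_of A"
  unfolding lattice_of_def by (auto intro!: image_eqI[of _ _ 0])

lemma is_packing_lattice_iff:
  "is_packing (lattice_of A) K \<longleftrightarrow> (\<forall>v\<in>lattice_of A. v \<noteq> 0 \<longrightarrow> v \<notin> interior_differences K)"
proof
  assume pk: "is_packing (lattice_of A) K"
  show "\<forall>v\<in>lattice_of A. v \<noteq> 0 \<longrightarrow> v \<notin> interior_differences K"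
  proof (intro ballI impI notI)
    fix v assume v: "v \<in> lattice_of A" "v \<noteq> 0" "v \<in> interior_differences K"
    then obtain x y where xy: "v = x - y" "x \<in> interior K" "y \<in> interior K"
      unfolding interior_differences_def by auto
    have "interior ((+) v ` K) \<inter> interior ((+) 0 ` K) = {}"
      using pk v zero_in_lattice_of unfolding is_packing_def by blast
    moreover have "x \<in> interior ((+) v ` K)"
      using xy unfolding interior_translation by (auto intro!: image_eqI[of _ _ y])
    ultimately show False using xy by auto
  qed
next
  assume H: "\<forall>v\<in>lattice_of A. v \<noteq> 0 \<longrightarrow> v \<notin> interior_differences K"
  show "is_packing (lattice_of A) K"
    unfolding is_packing_def
  proof (intro ballI impI)
    fix x y assume xy: "x \<in> lattice_of A" "y \<in> lattice_of A" "x \<noteq> y"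
    show "interior ((+) x ` K) \<inter> interior ((+) y ` K) = {}"
    proof (rule ccontr)
      assume "\<not> ?thesis"
      then obtain s t where st: "x + s = y + t" "s \<in> interior K" "t \<in> interior K"
        unfolding interior_translation by auto
      then have "x - y = t - s" by (simp add: algebra_simps)
      then have "x - y \<in> interior_differences K"
        using st unfolding interior_differences_def by auto
      then show False using H lattice_of_diff[OF xy(1,2)] xy(3) by auto
    qed
  qed
qed

lemma lattice_of_mult_subset:
  fixes A U :: "real ^ 'n ^ 'n"
  assumes "\<And>i j. U $ i $ j \<in> \<int>"
  shows "lattice_of (A ** U) \<subseteq> lattice_of A"
proof
  fix v assume "v \<in> lattice_of (A ** U)"
  then obtain z where z: "v = (A ** U) *v z" "\<forall>i. z $ i \<in> \<int>"
    unfolding lattice_of_def by auto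
  have "v = A *v (U *v z)" using z by (simp add: matrix_vector_mul_assoc)
  moreover have "\<forall>i. (U *v z) $ i \<in> \<int>"
    using assms z by (auto simp: matrix_vector_mult_def intro!: Ints_sum Ints_mult)
  ultimately show "v \<in> lattice_of A" unfolding lattice_of_def by blast
qed

lemma lattice_of_mult_unimodular:
  fixes A U V :: "real ^ 'n ^ 'n"
  assumes "\<And>i j. U $ i $ j \<in> \<int>" "\<And>i j. V $ i $ j \<in> \<int>" "U ** V = mat 1"
  shows "lattice_of (A ** U) = lattice_of A"
proof
  show "lattice_of (A ** U) \<subseteq> lattice_of A" by (rule lattice_of_mult_subset) fact
  have "lattice_of ((A ** U) ** V) \<subseteq> lattice_of (A ** U)"
    by (rule lattice_of_mult_subset) fact
  then show "lattice_of A \<subseteq> lattice_of (A ** U)"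
    by (simp add: matrix_mul_assoc[symmetric] assms)
qed

lemma column_in_lattice_of:
  fixes A :: "real ^ 'n ^ 'n"
  shows "column i A \<in> lattice_of A"
proof -
  have "column i A = A *v axis i 1" by (simp add: matrix_vector_mul_component vec_eq_iff column_def matrix_vector_mult_def axis_def if_distrib cong: if_cong)
  moreover have "\<forall>j. (axis i 1 :: real^'n) $ j \<in> \<int>" by (simp add: axis_def)
  ultimately show ?thesis unfolding lattice_of_def by blast
qed

lemma shear_columns_same_lattice:
  fixes A :: "real ^ 2 ^ 2" and s :: real
  assumes "s \<in> \<int>" "i \<noteq> j"
  obtains B where "lattice_of B = lattice_of A" "det B = det A"
    "column i B = column i A + s *\<^sub>R column j A" "column j B = column j A"
proof -
  define U :: "real \<Rightarrow> real^2^2" where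
    "U t = (\<chi> k l. if k = l then 1 else if k = j \<and> l = i then t else 0)" for t
  have ij: "(i = 1 \<and> j = 2) \<or> (i = 2 \<and> j = 1)" using assms(2) exhaust_2 by metis
  have "U s ** U (-s) = mat 1"
    using ij by (auto simp: U_def matrix_matrix_mult_def mat_def vec_eq_iff sum_2 forall_2)
  then have 1: "lattice_of (A ** U s) = lattice_of A"
    by (rule lattice_of_mult_unimodular[rotated 2]) (use assms in \<open>auto simp: U_def\<close>)
  have 2: "det (A ** U s) = det A" using ij unfolding det_mul by (auto simp: det_2 U_def)
  show ?thesis
    by (rule that[of "A ** U s"])
      (use ij 1 2 in \<open>auto simp: column_def matrix_matrix_mult_def U_def vec_eq_iff sum_2 algebra_simps\<close>)
qed

section \<open>Reduction of lattice bases and the densest packing\<close>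

text \<open>Both inequalities say that adding or subtracting one basis vector to the other does not lower the
sum of the squared lengths by more than \<open>\<epsilon>\<close>. Working with an approximate minimum of this sum
avoids having to show that the minimum is attained.\<close>

lemma reduced_basis:
  fixes A :: "real ^ 2 ^ 2"
  assumes "\<epsilon> > 0"
  obtains B where "lattice_of B = lattice_of A" "det B = det A"
    "2 * \<bar>column 1 B \<bullet> column 2 B\<bar> \<le> (norm (column 1 B))\<^sup>2 + \<epsilon>"
    "2 * \<bar>column 1 B \<bullet> column 2 B\<bar> \<le> (norm (column 2 B))\<^sup>2 + \<epsilon>"
proof -
  define T where "T = {B. lattice_of B = lattice_of A \<and> det B = det A}"
  define q where "q B = (norm (column 1 B))\<^sup>2 + (norm (column 2 B))\<^sup>2" for B :: "real^2^2"
  have bdd: "bdd_below (q ` T)" by (rule bdd_belowI[of _ 0]) (auto simp: q_def)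
  have "A \<in> T" by (simp add: T_def)
  then have "\<exists>x\<in>q ` T. x < Inf (q ` T) + \<epsilon>"
    using bdd assms by (intro cInf_lessD) auto
  then obtain B where B: "B \<in> T" "q B < Inf (q ` T) + \<epsilon>" by auto
  have min: "q B \<le> q B' + \<epsilon>" if "B' \<in> T" for B'
    using cInf_lower[OF imageI[OF that, of q] bdd] B by linarith
  have key: "- 2 * s * (column i B \<bullet> column j B) \<le> (norm (column j B))\<^sup>2 + \<epsilon>"
    if ij: "(i = 1 \<and> j = 2) \<or> (i = 2 \<and> j = 1)" and s: "s = 1 \<or> s = -1" for i j s
  proof -
    obtain B' where B': "lattice_of B' = lattice_of B" "det B' = det B"
      "column i B' = column i B + s *\<^sub>R column j B" "column j B' = column j B"
      by (rule shear_columns_same_lattice[of s i j B]) (use ij s in auto)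
    have "B' \<in> T" using B' B by (auto simp: T_def)
    from min[OF this] have
      "(norm (column i B))\<^sup>2 \<le> (norm (column i B + s *\<^sub>R column j B))\<^sup>2 + \<epsilon>"
      using B' ij by (auto simp: q_def)
    then show ?thesis
      using s by (auto simp: power2_norm_eq_inner algebra_simps inner_commute)
  qed
  have "2 * \<bar>column 1 B \<bullet> column 2 B\<bar> \<le> (norm (column 1 B))\<^sup>2 + \<epsilon>"
    using key[of 2 1 1] key[of 2 1 "-1"] by (auto simp: inner_commute abs_if)
  moreover have "2 * \<bar>column 1 B \<bullet> column 2 B\<bar> \<le> (norm (column 2 B))\<^sup>2 + \<epsilon>"
    using key[of 1 2 1] key[of 1 2 "-1"] by (auto simp: abs_if)
  ultimately show ?thesis using that B by (auto simp: T_def)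
qed

lemma det_squared_columns:
  fixes B :: "real ^ 2 ^ 2"
  shows "(det B)\<^sup>2 = (norm (column 1 B))\<^sup>2 * (norm (column 2 B))\<^sup>2 - (column 1 B \<bullet> column 2 B)\<^sup>2"
  by (simp add: power2_norm_eq_inner inner_vec_def sum_2 det_2 column_def)
    (simp add: algebra_simps power2_eq_square)

lemma column_nonzero:
  fixes B :: "real ^ 'n ^ 'n"
  assumes "det B \<noteq> 0"
  shows "column i B \<noteq> 0"
  using assms det_zero_column(2) by (auto simp: column_def row_def)

text \<open>Let \<open>n \<le> N\<close> be the squared lengths of a reduced basis. The squared determinant is \<open>n N\<close> minus the
square of the inner product, which is at most \<open>(n + \<epsilon>)/2\<close> in absolute value. Bounding \<open>N\<close> below by \<open>n\<close>, and \<open>n\<close> below by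
\<open>m\<^sup>2\<close>, gives a lower bound for the determinant that is sharp for the hexagonal lattice as
\<open>\<epsilon>\<close> tends to \<open>0\<close>; keeping \<open>N\<close> instead bounds the basis vectors in terms of the determinant.\<close>

lemma reduced_basis_estimates:
  fixes A :: "real ^ 2 ^ 2"
  assumes m: "m > 0" and short: "\<And>v. v \<in> lattice_of A \<Longrightarrow> v \<noteq> 0 \<Longrightarrow> m \<le> norm v"
    and inv: "det A \<noteq> 0" and \<epsilon>: "0 < \<epsilon>" "4 * \<epsilon> \<le> m\<^sup>2"
  obtains B where "lattice_of B = lattice_of A" "det B = det A"
    "3 * m\<^sup>2 * (m\<^sup>2 - \<epsilon>) \<le> 4 * (det A)\<^sup>2"
    "\<And>i. m\<^sup>2 * (norm (column i B))\<^sup>2 \<le> 2 * (det A)\<^sup>2"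
proof -
  obtain B where B: "lattice_of B = lattice_of A" "det B = det A"
    "2 * \<bar>column 1 B \<bullet> column 2 B\<bar> \<le> (norm (column 1 B))\<^sup>2 + \<epsilon>"
    "2 * \<bar>column 1 B \<bullet> column 2 B\<bar> \<le> (norm (column 2 B))\<^sup>2 + \<epsilon>"
    using reduced_basis[OF \<epsilon>(1)] .
  have len: "m\<^sup>2 \<le> (norm (column i B))\<^sup>2" for i
    using short[of "column i B"] column_in_lattice_of[of i B] column_nonzero[of B i] B inv m
    by (auto intro: power_mono)
  define n where "n = min ((norm (column 1 B))\<^sup>2) ((norm (column 2 B))\<^sup>2)"
  define N where "N = max ((norm (column 1 B))\<^sup>2) ((norm (column 2 B))\<^sup>2)"
  have nN: "m\<^sup>2 \<le> n" "n \<le> N" using len by (auto simp: n_def N_def)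
  have m2: "0 < m\<^sup>2" using m by simp
  have prod: "(norm (column 1 B))\<^sup>2 * (norm (column 2 B))\<^sup>2 = n * N"
    by (auto simp: n_def N_def min_def max_def)
  have "2 * \<bar>column 1 B \<bullet> column 2 B\<bar> \<le> n + \<epsilon>" using B by (auto simp: n_def)
  then have "(2 * \<bar>column 1 B \<bullet> column 2 B\<bar>)\<^sup>2 \<le> (n + \<epsilon>)\<^sup>2" by (intro power_mono) auto
  then have "4 * (column 1 B \<bullet> column 2 B)\<^sup>2 \<le> (n + \<epsilon>)\<^sup>2" by (simp add: power_mult_distrib)
  then have d: "4 * n * N - (n + \<epsilon>)\<^sup>2 \<le> 4 * (det A)\<^sup>2"
    using det_squared_columns[of B] B prod by simp
  have nn: "n * n \<le> n * N" by (rule mult_left_mono) (use nN m2 in linarith)+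
  have "3 * m\<^sup>2 * (m\<^sup>2 - \<epsilon>) \<le> (3 * n + \<epsilon>) * (n - \<epsilon>)"
    by (intro mult_mono) (use nN \<epsilon> m2 in linarith)+
  also have "\<dots> = 4 * n * n - (n + \<epsilon>)\<^sup>2" by (simp add: power2_eq_square algebra_simps)
  also have "\<dots> \<le> 4 * (det A)\<^sup>2" using nn d by linarith
  finally have 1: "3 * m\<^sup>2 * (m\<^sup>2 - \<epsilon>) \<le> 4 * (det A)\<^sup>2" .
  have "(n + \<epsilon>)\<^sup>2 \<le> (5/4 * n)\<^sup>2"
    by (rule power_mono) (use nN(1) \<epsilon> m2 in linarith)+
  also have "\<dots> = 25 / 16 * (n * n)" by (simp add: power2_eq_square)
  also have "\<dots> \<le> 2 * (n * N)" using nn zero_le_square[of n] by linarith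
  finally have "n * N \<le> 2 * (det A)\<^sup>2" using d by linarith
  moreover have "m\<^sup>2 * N \<le> n * N" by (rule mult_right_mono) (use nN m2 in linarith)+
  ultimately have N: "m\<^sup>2 * N \<le> 2 * (det A)\<^sup>2" by linarith
  have 2: "m\<^sup>2 * (norm (column i B))\<^sup>2 \<le> 2 * (det A)\<^sup>2" for i
  proof -
    have "(norm (column i B))\<^sup>2 \<le> N" using exhaust_2[of i] by (auto simp: N_def)
    then show ?thesis using N m2 by (meson mult_left_mono order_trans less_imp_le)
  qed
  show ?thesis using that[OF B(1,2) 1 2] .
qed

text \<open>Hermite's bound in dimension two, obtained by letting \<open>\<epsilon>\<close> tend to \<open>0\<close>.\<close>

lemma det_squared_ge_of_min_norm:
  fixes A :: "real ^ 2 ^ 2"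
  assumes m: "m > 0" and short: "\<And>v. v \<in> lattice_of A \<Longrightarrow> v \<noteq> 0 \<Longrightarrow> m \<le> norm v"
    and inv: "det A \<noteq> 0"
  shows "3 * m ^ 4 \<le> 4 * (det A)\<^sup>2"
proof (rule field_le_epsilon)
  fix e :: real assume e: "0 < e"
  define \<epsilon> where "\<epsilon> = min (e / (3 * m\<^sup>2)) (m\<^sup>2 / 4)"
  have m2: "0 < m\<^sup>2" using m by simp
  have \<epsilon>: "0 < \<epsilon>" "4 * \<epsilon> \<le> m\<^sup>2" "\<epsilon> \<le> e / (3 * m\<^sup>2)" using m e by (auto simp: \<epsilon>_def)
  obtain B where "3 * m\<^sup>2 * (m\<^sup>2 - \<epsilon>) \<le> 4 * (det A)\<^sup>2"
    by (rule reduced_basis_estimates[OF m short inv \<epsilon>(1,2)]) auto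
  moreover have "3 * m\<^sup>2 * \<epsilon> \<le> e" using \<epsilon>(3) m2 by (simp add: field_simps)
  ultimately show "3 * m ^ 4 \<le> 4 * (det A)\<^sup>2 + e"
    by (simp add: algebra_simps power2_eq_square power4_eq_xxxx)
qed

lemma nonzero_lattice_vector_notin:
  fixes K :: "(real ^ 'n) set"
  assumes "is_packing (lattice_of A) K" "ball 0 m \<subseteq> interior_differences K"
    "v \<in> lattice_of A" "v \<noteq> 0"
  shows "m \<le> norm v"
  using assms unfolding is_packing_lattice_iff by (force simp: subset_iff)

text \<open>Up to a change of basis, every packing lattice whose determinant does not exceed that of a given
one has a basis in the set \<open>C\<close> of bounded bases with determinant bounded away from \<open>0\<close>. The
packing condition is closed, because it forbids each vector \<open>B *v z\<close> to lie in an open set.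
Hence \<open>C\<close> is compact and the determinant attains its minimum.\<close>

lemma minimal_packing_lattice_exists:
  fixes K :: "(real ^ 2) set"
  assumes m: "m > 0" "ball 0 m \<subseteq> interior_differences K"
    and ex: "invertible A1" "is_packing (lattice_of A1) K"
  obtains A0 :: "real ^ 2 ^ 2" where "invertible A0" "is_packing (lattice_of A0) K"
    "\<And>A. invertible A \<Longrightarrow> is_packing (lattice_of A) K \<Longrightarrow> \<bar>det A0\<bar> \<le> \<bar>det A\<bar>"
proof -
  \<comment> \<open>The bounds that reduced_basis_estimates gives for bases of determinant at most that of A1, with the slack m^2/4.\<close>
  define R where "R = 2 * (det A1)\<^sup>2 / m\<^sup>2"
  define Z where "Z = {z :: real^2. (\<forall>i. z $ i \<in> \<int>) \<and> z \<noteq> 0}"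
  define C where "C = {B :: real^2^2. m\<^sup>2 / 2 \<le> \<bar>det B\<bar> \<and> (\<forall>i. (norm (column i B))\<^sup>2 \<le> R) \<and>
       (\<forall>z\<in>Z. B *v z \<notin> interior_differences K)}"
  have m2: "0 < m\<^sup>2" using m by simp
  have C_packing: "invertible B \<and> is_packing (lattice_of B) K" if "B \<in> C" for B
  proof -
    have "det B \<noteq> 0" using that m2 by (auto simp: C_def)
    moreover have "v \<notin> interior_differences K" if "v \<in> lattice_of B" "v \<noteq> 0" for v
      using that \<open>B \<in> C\<close> by (force simp: C_def Z_def lattice_of_def)
    then have "is_packing (lattice_of B) K" unfolding is_packing_lattice_iff by blast
    ultimately show ?thesis by (simp add: invertible_det_nz)
  qed
  have reduce: "\<exists>B\<in>C. \<bar>det B\<bar> = \<bar>det A\<bar>"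
    if A: "invertible A" "is_packing (lattice_of A) K" "\<bar>det A\<bar> \<le> \<bar>det A1\<bar>" for A
  proof -
    have dA: "det A \<noteq> 0" using A(1) by (simp add: invertible_det_nz)
    obtain B where B: "lattice_of B = lattice_of A" "det B = det A"
       "3 * m\<^sup>2 * (m\<^sup>2 - m\<^sup>2 / 4) \<le> 4 * (det A)\<^sup>2"
       "\<And>i. m\<^sup>2 * (norm (column i B))\<^sup>2 \<le> 2 * (det A)\<^sup>2"
      by (rule reduced_basis_estimates[of m A "m\<^sup>2 / 4"])
        (use m2 m dA nonzero_lattice_vector_notin[OF A(2) m(2)] in auto)
    have "(m\<^sup>2 / 2)\<^sup>2 \<le> 9 / 16 * (m\<^sup>2 * m\<^sup>2)"
      using zero_le_square[of "m\<^sup>2"] by (simp add: power2_eq_square[of "m\<^sup>2 / 2"])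
    also have "\<dots> \<le> \<bar>det B\<bar>\<^sup>2" using B(2,3) by (simp add: power2_eq_square)
    finally have "(m\<^sup>2 / 2)\<^sup>2 \<le> \<bar>det B\<bar>\<^sup>2" .
    then have 1: "m\<^sup>2 / 2 \<le> \<bar>det B\<bar>" by (rule power2_le_imp_le) simp
    have "(det A)\<^sup>2 \<le> (det A1)\<^sup>2" using A(3) by (simp add: abs_le_square_iff)
    then have 2: "(norm (column i B))\<^sup>2 \<le> R" for i
      using B(4)[of i] m2 by (simp add: R_def field_simps)
    have 3: "B *v z \<notin> interior_differences K" if "z \<in> Z" for z
    proof -
      have "B *v z \<in> lattice_of A" using that B(1) by (auto simp: Z_def lattice_of_def)
      moreover have "B *v z \<noteq> 0"
      proof
        assume z0: "B *v z = 0"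
        have "invertible B" using B dA by (simp add: invertible_det_nz)
        then have "z = 0" using z0
          by (metis invertible_def matrix_vector_mul_assoc matrix_vector_mul_lid matrix_vector_mult_0_right)
        then show False using that by (simp add: Z_def)
      qed
      ultimately show ?thesis using A(2) unfolding is_packing_lattice_iff by auto
    qed
    have "B \<in> C" using 1 2 3 by (auto simp: C_def)
    then show ?thesis using B(2) by (intro bexI[of _ B]) simp_all
  qed
  have cont_col: "continuous_on UNIV (\<lambda>B :: real^2^2. column i B)" for i
    unfolding column_def by (intro continuous_intros)
  have cont_det: "continuous_on UNIV (\<lambda>B :: real^2^2. \<bar>det B\<bar>)"
    unfolding det_2 by (intro continuous_intros)
  have cont_mul: "continuous_on UNIV (\<lambda>B :: real^2^2. B *v z)" for z
    unfolding matrix_vector_mult_def by (intro continuous_intros)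
  have "C = {B. m\<^sup>2 / 2 \<le> \<bar>det B\<bar>} \<inter> (\<Inter>i. {B. (norm (column i B))\<^sup>2 \<le> R}) \<inter>
     (\<Inter>z\<in>Z. (\<lambda>B. B *v z) -` (- interior_differences K))"
    by (auto simp: C_def)
  moreover have "closed {B :: real^2^2. m\<^sup>2 / 2 \<le> \<bar>det B\<bar>}"
    by (intro closed_Collect_le cont_det continuous_intros)
  moreover have "closed {B :: real^2^2. (norm (column i B))\<^sup>2 \<le> R}" for i
    by (intro closed_Collect_le cont_col continuous_intros)
  moreover have "closed ((\<lambda>B :: real^2^2. B *v z) -` (- interior_differences K))" for z
    using open_interior_differences cont_mul closed_vimage by blast
  ultimately have "closed C" by (auto intro!: closed_Int closed_INT)
  moreover have "bounded C"
  proof (rule boundedI)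
    fix B assume B: "B \<in> C"
    have e: "\<bar>B $ i $ j\<bar> \<le> sqrt R" for i j
    proof -
      have "\<bar>B $ i $ j\<bar> \<le> norm (column j B)"
        using component_le_norm_cart[of "column j B" i] by (simp add: column_def)
      also have "\<dots> \<le> sqrt R" using B by (intro real_le_rsqrt) (auto simp: C_def)
      finally show ?thesis .
    qed
    have "norm B \<le> (\<Sum>i\<in>UNIV. norm (B $ i))" 
      unfolding norm_vec_def by (rule L2_set_le_sum) simp
    also have "\<dots> \<le> (\<Sum>i\<in>UNIV. \<Sum>j\<in>UNIV. \<bar>B $ i $ j\<bar>)"
      by (intro sum_mono norm_le_l1_cart)
    also have "\<dots> \<le> (\<Sum>i\<in>(UNIV :: 2 set). \<Sum>j\<in>(UNIV :: 2 set). sqrt R)"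
      by (intro sum_mono e)
    finally show "norm B \<le> 4 * sqrt R" by simp
  qed
  ultimately have comp: "compact C" by (simp add: compact_eq_bounded_closed)
  obtain B1 where B1: "B1 \<in> C" "\<bar>det B1\<bar> = \<bar>det A1\<bar>" using reduce[OF ex] by auto
  obtain A0 where A0: "A0 \<in> C" "\<And>B. B \<in> C \<Longrightarrow> \<bar>det A0\<bar> \<le> \<bar>det B\<bar>"
    using continuous_attains_inf[OF comp, of "\<lambda>B. \<bar>det B\<bar>"] B1
      continuous_on_subset[OF cont_det] by blast
  show ?thesis
  proof (rule that[of A0])
    show "\<bar>det A0\<bar> \<le> \<bar>det A\<bar>" if A: "invertible A" "is_packing (lattice_of A) K" for A
    proof (cases "\<bar>det A\<bar> \<le> \<bar>det A1\<bar>")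
      case True
      then show ?thesis using reduce[OF A] A0(2) by force
    next
      case False
      then show ?thesis using B1 A0(2)[OF B1(1)] by linarith
    qed
  qed (use C_packing[OF A0(1)] in auto)
qed

lemma lattice_packing_density_attained:
  fixes K :: "(real ^ 2) set"
  assumes m: "m > 0" "ball 0 m \<subseteq> interior_differences K"
    and ex: "invertible A1" "is_packing (lattice_of A1) K"
  shows "\<exists>A :: real ^ 2 ^ 2. invertible A \<and> is_packing (lattice_of A) K \<and>
           lattice_packing_density K = measure lebesgue K / \<bar>det A\<bar>" (is ?att)
    and "measure lebesgue K / \<bar>det A1\<bar> \<le> lattice_packing_density K"
proof -
  define P where "P r \<longleftrightarrow> (\<exists>A :: real ^ 2 ^ 2. invertible A \<and> is_packing (lattice_of A) K \<and>
        r = measure lebesgue K / \<bar>det A\<bar>)" for r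
  have dens: "lattice_packing_density K = (GREATEST r. P r)"
    by (simp add: lattice_packing_density_def P_def)
  obtain A0 :: "real ^ 2 ^ 2" where A0: "invertible A0" "is_packing (lattice_of A0) K"
    "\<And>A. invertible A \<Longrightarrow> is_packing (lattice_of A) K \<Longrightarrow> \<bar>det A0\<bar> \<le> \<bar>det A\<bar>"
    using minimal_packing_lattice_exists[OF m ex] by blast
  have P0: "P (measure lebesgue K / \<bar>det A0\<bar>)" using A0 by (auto simp: P_def)
  have upper: "r \<le> measure lebesgue K / \<bar>det A0\<bar>" if Pr: "P r" for r
  proof -
    obtain A where A: "invertible A" "is_packing (lattice_of A) K"
      "r = measure lebesgue K / \<bar>det A\<bar>" using Pr by (auto simp: P_def)
    have "0 < \<bar>det A0\<bar>" using A0(1) by (simp add: invertible_det_nz)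
    then show ?thesis using A0(3)[OF A(1,2)] A(3) by (auto intro!: divide_left_mono)
  qed
  have eq: "lattice_packing_density K = measure lebesgue K / \<bar>det A0\<bar>"
    unfolding dens by (rule Greatest_equality) (fact P0, fact upper)
  then show ?att using A0 by auto
  show "measure lebesgue K / \<bar>det A1\<bar> \<le> lattice_packing_density K"
    unfolding eq by (rule upper) (use ex in \<open>auto simp: P_def\<close>)
qed

section \<open>Packing lattices from symmetric hexagons in the polar body\<close>

definition det2 :: "real ^ 2 \<Rightarrow> real ^ 2 \<Rightarrow> real" where
  "det2 a b = a $ 1 * b $ 2 - a $ 2 * b $ 1"

lemma det2_relation:
  "det2 a c * (b \<bullet> x) = det2 b c * (a \<bullet> x) + det2 a b * (c \<bullet> x)"
  by (simp add: det2_def inner_vec_def sum_2 algebra_simps)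

text \<open>When \<open>a\<close> and \<open>c\<close> are linearly independent, the values of \<open>a\<close> and \<open>c\<close> on a vector are coordinates of
it, so a lattice may be prescribed by the coordinates of its basis.\<close>

lemma matrix_with_dual_coordinates:
  assumes "det2 a c \<noteq> 0"
  obtains A :: "real ^ 2 ^ 2" where
    "\<And>z. a \<bullet> (A *v z) = u1 * z $ 1 + u2 * z $ 2"
    "\<And>z. c \<bullet> (A *v z) = t1 * z $ 1 + t2 * z $ 2"
    "det A = (u1 * t2 - u2 * t1) / det2 a c"
proof -
  define r where "r = det2 a c"
  have r: "r \<noteq> 0" "r = a $ 1 * c $ 2 - a $ 2 * c $ 1" using assms by (auto simp: r_def det2_def)
  define col :: "real \<Rightarrow> real \<Rightarrow> real^2" where
    "col u t = vector [(u * c $ 2 - t * a $ 2) / r, (t * a $ 1 - u * c $ 1) / r]" for u t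
  have ac: "a \<bullet> col u t = u" "c \<bullet> col u t = t" for u t
  proof -
    have "a \<bullet> col u t = (a $ 1 * (u * c $ 2 - t * a $ 2) + a $ 2 * (t * a $ 1 - u * c $ 1)) / r"
      by (simp add: col_def inner_vec_def sum_2 add_divide_distrib)
    also have "a $ 1 * (u * c $ 2 - t * a $ 2) + a $ 2 * (t * a $ 1 - u * c $ 1) = u * r"
      unfolding r(2) by (simp add: algebra_simps)
    finally show "a \<bullet> col u t = u" using r(1) by simp
    have "c \<bullet> col u t = (c $ 1 * (u * c $ 2 - t * a $ 2) + c $ 2 * (t * a $ 1 - u * c $ 1)) / r"
      by (simp add: col_def inner_vec_def sum_2 add_divide_distrib)
    also have "c $ 1 * (u * c $ 2 - t * a $ 2) + c $ 2 * (t * a $ 1 - u * c $ 1) = t * r"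
      unfolding r(2) by (simp add: algebra_simps)
    finally show "c \<bullet> col u t = t" using r(1) by simp
  qed
  define A :: "real^2^2" where "A = (\<chi> i j. if j = 1 then col u1 t1 $ i else col u2 t2 $ i)"
  have Az: "A *v z = z $ 1 *\<^sub>R col u1 t1 + z $ 2 *\<^sub>R col u2 t2" for z
    by (simp add: A_def matrix_vector_mult_def vec_eq_iff sum_2)
  have "det A * r * r = (u1 * t2 - u2 * t1) * r"
  proof -
    have "det A * r * r = ((u1 * c $ 2 - t1 * a $ 2) * (t2 * a $ 1 - u2 * c $ 1)
        - (u2 * c $ 2 - t2 * a $ 2) * (t1 * a $ 1 - u1 * c $ 1))"
      using r(1) by (simp add: A_def det_2 col_def field_simps)
    also have "\<dots> = (u1 * t2 - u2 * t1) * r" unfolding r(2) by (simp add: algebra_simps)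
    finally show ?thesis .
  qed
  then have "det A = (u1 * t2 - u2 * t1) / r" using r(1) by (simp add: eq_divide_eq)
  then show ?thesis
    by (intro that[of A]) (simp_all add: Az ac inner_add_right r_def mult.commute)
qed

text \<open>With the variables ordered, Schur's expression is visibly a sum of two nonnegative terms, and both
vanish only when the variables agree.\<close>

lemma schur_inequality_ordered:
  fixes x y z :: real
  assumes "y \<le> x" "z \<le> y" "0 < z"
  shows "0 \<le> x * (x - y) * (x - z) + y * (y - x) * (y - z) + z * (z - x) * (z - y)"
    and "x * (x - y) * (x - z) + y * (y - x) * (y - z) + z * (z - x) * (z - y) = 0
           \<Longrightarrow> x = y \<and> y = z"
proof -
  have eq: "x * (x - y) * (x - z) + y * (y - x) * (y - z) + z * (z - x) * (z - y)
      = (x - y)\<^sup>2 * (x + y - z) + z * ((x - z) * (y - z))"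
    by (simp add: power2_eq_square algebra_simps)
  have 1: "0 \<le> (x - y)\<^sup>2 * (x + y - z)" "0 \<le> z * ((x - z) * (y - z))" using assms by auto
  show "0 \<le> x * (x - y) * (x - z) + y * (y - x) * (y - z) + z * (z - x) * (z - y)"
    unfolding eq using 1 by linarith
  assume "x * (x - y) * (x - z) + y * (y - x) * (y - z) + z * (z - x) * (z - y) = 0"
  then have "(x - y)\<^sup>2 * (x + y - z) = 0" "z * ((x - z) * (y - z)) = 0"
    unfolding eq using 1 by linarith+
  then show "x = y \<and> y = z" using assms by auto
qed

text \<open>Schur's inequality in the form in which it compares areas: for \<open>p = det2 a b\<close>, \<open>q = det2 b c\<close>,
\<open>r = det2 a c\<close> in convex position, \<open>p + q + r\<close> is the area of the hexagon with vertices \<open>\<plusminus>a, \<plusminus>b, \<plusminus>c\<close> and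
\<open>(4 p q - (p + q - r)\<^sup>2) / (p q r)\<close> is the area of its polar.\<close>

lemma schur_inequality:
  fixes p q r :: real
  assumes "0 < p" "0 < q" "0 < r"
  shows "(p + q + r) * (4 * p * q - (p + q - r)\<^sup>2) \<le> 9 * p * q * r"
    and "(p + q + r) * (4 * p * q - (p + q - r)\<^sup>2) = 9 * p * q * r \<Longrightarrow> p = q \<and> q = r"
proof -
  define s where "s x y z = x * (x - y) * (x - z) + y * (y - x) * (y - z) + z * (z - x) * (z - y)"
    for x y z :: real
  have ordered: "0 \<le> s x y z \<and> (s x y z = 0 \<longrightarrow> x = y \<and> y = z)" if "y \<le> x" "z \<le> y" "0 < z" for x y z
    using schur_inequality_ordered[OF that] by (simp add: s_def)
  have sym: "s q p r = s p q r" "s p r q = s p q r" "s r p q = s p q r"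
    "s q r p = s p q r" "s r q p = s p q r"
    by (simp_all add: s_def algebra_simps)
  have "(q \<le> p \<and> r \<le> q) \<or> (r \<le> p \<and> q \<le> r) \<or> (p \<le> q \<and> r \<le> p) \<or>
      (r \<le> q \<and> p \<le> r) \<or> (p \<le> r \<and> q \<le> p) \<or> (q \<le> r \<and> p \<le> q)" by linarith
  then have "0 \<le> s p q r \<and> (s p q r = 0 \<longrightarrow> p = q \<and> q = r)"
    using ordered[of q p r] ordered[of r p q] ordered[of p q r] ordered[of r q p]
      ordered[of p r q] ordered[of q r p] assms unfolding sym by blast
  moreover have "9 * p * q * r - (p + q + r) * (4 * p * q - (p + q - r)\<^sup>2) = s p q r"
    by (simp add: s_def power2_eq_square algebra_simps)
  ultimately show "(p + q + r) * (4 * p * q - (p + q - r)\<^sup>2) \<le> 9 * p * q * r"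
    and "(p + q + r) * (4 * p * q - (p + q - r)\<^sup>2) = 9 * p * q * r \<Longrightarrow> p = q \<and> q = r"
    by auto
qed

lemma polar_bound_interior:
  fixes K :: "(real ^ 'n) set"
  assumes "a \<in> polar_body K" "x \<in> interior K"
  shows "a \<bullet> x < 1"
proof (cases "a = 0")
  case False
  obtain e where e: "e > 0" "cball x e \<subseteq> K" using assms(2) by (meson mem_interior_cball)
  have "x + (e / norm a) *\<^sub>R a \<in> cball x e" using e False by (simp add: dist_norm)
  then have "(x + (e / norm a) *\<^sub>R a) \<bullet> a \<le> 1"
    using e assms(1) by (auto simp: polar_body_def)
  moreover have "0 < (e / norm a) * (a \<bullet> a)" using e False by simp
  ultimately show ?thesis by (simp add: inner_add_left inner_add_right inner_commute)
qed simp

lemma uminus_in_polar: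
  assumes "centrally_symmetric K" "a \<in> polar_body K"
  shows "- a \<in> polar_body K"
  using assms unfolding centrally_symmetric_def polar_body_def
  by (smt (verit, best) image_eqI inner_minus_left inner_minus_right mem_Collect_eq)

lemma interior_uminus:
  assumes "centrally_symmetric K" "x \<in> interior K"
  shows "- x \<in> interior K"
proof -
  have "interior (uminus ` K) = uminus ` interior K"
    by (rule interior_injective_linear_image) (auto intro!: linearI injI)
  then show ?thesis using assms unfolding centrally_symmetric_def by force
qed

lemma polar_bound_differences:
  fixes K :: "(real ^ 'n) set"
  assumes "centrally_symmetric K" "a \<in> polar_body K" "v \<in> interior_differences K"
  shows "\<bar>a \<bullet> v\<bar> < 2"
proof -
  obtain x y where v: "v = x - y" "x \<in> interior K" "y \<in> interior K"
    using assms(3) by (auto simp: interior_differences_def)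
  have "\<bar>a \<bullet> z\<bar> < 1" if "z \<in> interior K" for z
    using polar_bound_interior[OF assms(2) that]
      polar_bound_interior[OF uminus_in_polar[OF assms(1,2)] that] by simp
  from this[OF v(2)] this[OF v(3)] show ?thesis by (simp add: v inner_diff_right)
qed

text \<open>A point \<open>a\<close> of the polar body is less than \<open>1\<close> in absolute value on the interior of \<open>K\<close>, so a difference of two interior
points has \<open>\<bar>a \<bullet> v\<bar> < 2\<close>. A lattice packs as soon as every nonzero vector is excluded in this way by
some \<open>a\<close>.\<close>

lemma packing_of_polar_bounds:
  fixes K :: "(real ^ 'n) set"
  assumes "centrally_symmetric K" "F \<subseteq> polar_body K"
    and "\<And>z. (\<forall>i. z $ i \<in> \<int>) \<Longrightarrow> z \<noteq> 0 \<Longrightarrow> \<exists>a\<in>F. 2 \<le> \<bar>a \<bullet> (A *v z)\<bar>"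
  shows "is_packing (lattice_of A) K"
  unfolding is_packing_lattice_iff
proof (intro ballI impI notI)
  fix v assume v: "v \<in> lattice_of A" "v \<noteq> 0" "v \<in> interior_differences K"
  then obtain z where z: "v = A *v z" "\<forall>i. z $ i \<in> \<int>" by (auto simp: lattice_of_def)
  with v have "z \<noteq> 0" by auto
  then obtain a where "a \<in> F" "2 \<le> \<bar>a \<bullet> v\<bar>" using assms(3)[of z] z by auto
  then show False using polar_bound_differences[OF assms(1) _ v(3), of a] assms(2) by auto
qed

lemma Ints_trichotomy:
  fixes x :: real
  assumes "x \<in> \<int>"
  shows "x \<le> -1 \<or> x = 0 \<or> 1 \<le> x"
proof -
  obtain k where "x = of_int k" using assms by (auto elim: Ints_cases)
  then show ?thesis by (cases "k \<le> -1"; cases "k = 0") auto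
qed

lemma parallelogram_packing:
  fixes K :: "(real ^ 2) set"
  assumes "centrally_symmetric K" "a \<in> polar_body K" "c \<in> polar_body K" "0 < det2 a c"
  obtains A :: "real ^ 2 ^ 2" where "invertible A" "is_packing (lattice_of A) K"
    "\<bar>det A\<bar> = 4 / det2 a c"
proof -
  obtain A :: "real ^ 2 ^ 2" where A: "\<And>z. a \<bullet> (A *v z) = 2 * z $ 1 + 0 * z $ 2"
    "\<And>z. c \<bullet> (A *v z) = 0 * z $ 1 + 2 * z $ 2" "det A = (2 * 2 - 0 * 0) / det2 a c"
    using matrix_with_dual_coordinates[of a c] assms(4) by (metis less_irrefl)
  show ?thesis
  proof (rule that)
    show "invertible A" using A(3) assms(4) by (simp add: invertible_det_nz)
    show "\<bar>det A\<bar> = 4 / det2 a c" using A(3) assms(4) by simp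
    show "is_packing (lattice_of A) K"
    proof (rule packing_of_polar_bounds[of _ "{a, c}"])
      fix z :: "real^2" assume z: "\<forall>i. z $ i \<in> \<int>" "z \<noteq> 0"
      then have "z $ 1 \<noteq> 0 \<or> z $ 2 \<noteq> 0" by (simp add: vec_eq_iff forall_2)
      then show "\<exists>a\<in>{a, c}. 2 \<le> \<bar>a \<bullet> (A *v z)\<bar>"
        using Ints_trichotomy[of "z $ 1"] Ints_trichotomy[of "z $ 2"] z A by auto
    qed (use assms in auto)
  qed
qed

text \<open>The lattice is the one for which translates of the polar hexagon tile the plane. Its basis
consists of twice the midpoints of the edges of that hexagon on which \<open>a\<close> and \<open>c\<close> take the value \<open>1\<close>, and the sum of the two
basis vectors is twice the midpoint of the edge belonging to \<open>b\<close>. The strict triangle inequalities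
say that no vertex of the hexagon is redundant.\<close>

lemma hexagon_packing:
  fixes K :: "(real ^ 2) set" and a b c :: "real ^ 2"
  defines "p \<equiv> det2 a b" and "q \<equiv> det2 b c" and "r \<equiv> det2 a c"
  assumes K: "centrally_symmetric K" "a \<in> polar_body K" "b \<in> polar_body K" "c \<in> polar_body K"
    and tri: "p < q + r" "q < p + r" "r < p + q"
  obtains A :: "real ^ 2 ^ 2" where "invertible A" "is_packing (lattice_of A) K"
    "\<bar>det A\<bar> = (4 * p * q - (p + q - r)\<^sup>2) / (p * q * r)"
proof -
  have pos: "0 < p" "0 < q" "0 < r" using tri by auto
  define \<alpha> where "\<alpha> = (p + q - r) / q"
  define \<beta> where "\<beta> = (p + q - r) / p"
  obtain A :: "real ^ 2 ^ 2" where A: "\<And>z. a \<bullet> (A *v z) = 2 * z $ 1 + (- \<alpha>) * z $ 2"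
    "\<And>z. c \<bullet> (A *v z) = (- \<beta>) * z $ 1 + 2 * z $ 2" "det A = (2 * 2 - (- \<alpha>) * (- \<beta>)) / r"
    using matrix_with_dual_coordinates[of a c] pos unfolding r_def by (metis less_irrefl)
  define \<gamma> where "\<gamma> = (q + r - p) / r"
  define \<delta> where "\<delta> = (p + r - q) / r"
  have sgn: "0 \<le> \<alpha>" "0 \<le> \<beta>" "0 \<le> \<gamma>" "0 \<le> \<delta>" "\<gamma> + \<delta> = 2"
    using tri pos by (auto simp: \<alpha>_def \<beta>_def \<gamma>_def \<delta>_def add_divide_distrib[symmetric])
  have b: "b \<bullet> (A *v z) = \<gamma> * z $ 1 + \<delta> * z $ 2" for z
  proof -
    have "r * (b \<bullet> (A *v z)) = q * (2 * z $ 1 - \<alpha> * z $ 2) + p * (2 * z $ 2 - \<beta> * z $ 1)"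
      using det2_relation[of a c b "A *v z"] A by (simp add: p_def q_def r_def)
    also have "\<dots> = r * (\<gamma> * z $ 1 + \<delta> * z $ 2)"
      using pos by (simp add: \<alpha>_def \<beta>_def \<gamma>_def \<delta>_def field_simps)
    finally show ?thesis using pos by simp
  qed
  have "(4 - \<alpha> * \<beta>) * (p * q) = 4 * p * q - (p + q - r)\<^sup>2"
  proof -
    have "(4 - \<alpha> * \<beta>) * (p * q) = 4 * p * q - (\<alpha> * q) * (\<beta> * p)" by (simp add: algebra_simps)
    also have "\<alpha> * q = p + q - r" using pos by (simp add: \<alpha>_def)
    also have "\<beta> * p = p + q - r" using pos by (simp add: \<beta>_def)
    finally show ?thesis by (simp add: power2_eq_square)
  qed
  then have det: "det A = (4 * p * q - (p + q - r)\<^sup>2) / (p * q * r)"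
  proof -
    have "det A * (p * q * r) = (det A * r) * (p * q)" by simp
    also have "det A * r = 4 - \<alpha> * \<beta>" using A(3) pos by simp
    finally show ?thesis using \<open>(4 - \<alpha> * \<beta>) * (p * q) = _\<close> pos by (simp add: eq_divide_eq)
  qed
  have "4 * p * q - (p + q - r)\<^sup>2 = (r + p - q) * (r + q - p) + 2 * (r * (p + q - r))"
    by (simp add: power2_eq_square algebra_simps)
  moreover have "0 < (r + p - q) * (r + q - p)" "0 < r * (p + q - r)" using tri pos by auto
  ultimately have "0 < det A" unfolding det using pos by (intro divide_pos_pos mult_pos_pos) linarith
  show ?thesis
  proof (rule that)
    show "invertible A" using \<open>0 < det A\<close> by (simp add: invertible_det_nz)
    show "\<bar>det A\<bar> = (4 * p * q - (p + q - r)\<^sup>2) / (p * q * r)"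
      using \<open>0 < det A\<close> unfolding det[symmetric] by simp
    show "is_packing (lattice_of A) K"
    proof (rule packing_of_polar_bounds[of _ "{a, b, c}"])
      \<comment> \<open>The functional that excludes a vector depends on the signs of its integer coordinates: a or c if they differ or one vanishes, b if they agree.\<close>
      have main: "2 \<le> 2 * m - \<alpha> * n \<or> 2 \<le> 2 * n - \<beta> * m \<or> 2 \<le> \<gamma> * m + \<delta> * n"
        if "(1 \<le> m \<and> n \<le> 0) \<or> (m \<le> 0 \<and> 1 \<le> n) \<or> (1 \<le> m \<and> 1 \<le> n)" for m n :: real
      proof -
        have "2 \<le> 2 * m - \<alpha> * n" if "1 \<le> m" "n \<le> 0"
          using mult_nonneg_nonpos[OF sgn(1) that(2)] that by linarith
        moreover have "2 \<le> 2 * n - \<beta> * m" if "1 \<le> n" "m \<le> 0"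
          using mult_nonneg_nonpos[OF sgn(2) that(2)] that by linarith
        moreover have "2 \<le> \<gamma> * m + \<delta> * n" if "1 \<le> m" "1 \<le> n"
          using mult_left_mono[OF that(1) sgn(3)] mult_left_mono[OF that(2) sgn(4)] sgn(5) by linarith
        ultimately show ?thesis using that by blast
      qed
      fix z :: "real^2" assume z: "\<forall>i. z $ i \<in> \<int>" "z \<noteq> 0"
      then have "z $ 1 \<noteq> 0 \<or> z $ 2 \<noteq> 0" by (simp add: vec_eq_iff forall_2)
      then show "\<exists>x\<in>{a, b, c}. 2 \<le> \<bar>x \<bullet> (A *v z)\<bar>"
        using Ints_trichotomy[of "z $ 1"] Ints_trichotomy[of "z $ 2"] z(1)
          main[of "z $ 1" "z $ 2"] main[of "- z $ 1" "- z $ 2"]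
        unfolding bex_simps A b by (smt (verit) mult_minus_left mult_minus_right)
    qed (use K in auto)
  qed
qed

text \<open>If one of the three determinants is at least half of their sum, the parallelogram it spans already
gives a lattice of determinant at most \<open>8 / S\<close>. Otherwise the triangle inequalities
needed for the hexagonal lattice hold.\<close>

lemma packing_from_polar_points:
  fixes K :: "(real ^ 2) set"
  assumes K: "centrally_symmetric K" "a \<in> polar_body K" "b \<in> polar_body K" "c \<in> polar_body K"
    and S: "S = det2 a b + det2 b c + det2 a c" "0 < S"
  obtains A :: "real ^ 2 ^ 2" where "invertible A" "is_packing (lattice_of A) K"
    "\<bar>det A\<bar> \<le> 9 / S" "\<bar>det A\<bar> = 9 / S \<Longrightarrow> det2 a b = det2 b c \<and> det2 b c = det2 a c"
proof -
  note result = that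
  have para: thesis if xy: "x \<in> polar_body K" "y \<in> polar_body K" "S \<le> 2 * det2 x y" for x y
  proof -
    have "0 < det2 x y" using xy S by linarith
    then obtain A :: "real ^ 2 ^ 2" where A: "invertible A" "is_packing (lattice_of A) K"
      "\<bar>det A\<bar> = 4 / det2 x y" using parallelogram_packing[OF K(1) xy(1,2)] \<open>0 < det2 x y\<close> by metis
    have "4 / det2 x y < 9 / S" using \<open>0 < det2 x y\<close> S(2) xy(3) by (simp add: field_simps)
    then show thesis using A by (intro result[of A]) auto
  qed
  show thesis
  proof (cases "S \<le> 2 * det2 a b \<or> S \<le> 2 * det2 b c \<or> S \<le> 2 * det2 a c")
    case True
    then show thesis using para K by blast
  next
    case False
    define p q r where "p = det2 a b" and "q = det2 b c" and "r = det2 a c"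
    have tri: "p < q + r" "q < p + r" "r < p + q" and S': "S = p + q + r"
      using False S by (auto simp: p_def q_def r_def)
    have pos: "0 < p" "0 < q" "0 < r" using tri by auto
    obtain A :: "real ^ 2 ^ 2" where A: "invertible A" "is_packing (lattice_of A) K"
      "\<bar>det A\<bar> = (4 * p * q - (p + q - r)\<^sup>2) / (p * q * r)"
      using hexagon_packing[OF K] tri unfolding p_def q_def r_def by metis
    show thesis
    proof (rule result[OF A(1,2)])
      show "\<bar>det A\<bar> \<le> 9 / S"
        using schur_inequality(1)[OF pos] pos unfolding A(3) S' by (simp add: field_simps)
      show "det2 a b = det2 b c \<and> det2 b c = det2 a c" if "\<bar>det A\<bar> = 9 / S"
      proof -
        have "(p + q + r) * (4 * p * q - (p + q - r)\<^sup>2) = 9 * p * q * r"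
          using that pos unfolding A(3) S' by (simp add: frac_eq_eq) (simp add: algebra_simps)
        then show ?thesis using schur_inequality(2)[OF pos] by (simp add: p_def q_def r_def)
      qed
    qed
  qed
qed

section \<open>Area of a planar body by vertical slices\<close>

abbreviation pt :: "real \<Rightarrow> real \<Rightarrow> real ^ 2" where
  "pt x y \<equiv> vector [x, y]"

lemma pt_components: "pt (v $ 1) (v $ 2) = v"
  by (simp add: vec_eq_iff forall_2)

lemma pt_combination: "u *\<^sub>R pt x y + v *\<^sub>R pt x' y' = pt (u * x + v * x') (u * y + v * y')"
  by (simp add: vec_eq_iff forall_2)

lemma pt_continuous: "continuous_on UNIV (\<lambda>z. pt (fst z) (snd z))"
proof -
  have eq: "(\<lambda>z. pt (fst z) (snd z)) = (\<lambda>z. \<chi> i. if i = 1 then fst z else snd z)"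
    by (auto simp: vec_eq_iff forall_2)
  show ?thesis unfolding eq
  proof (rule continuous_on_vec_lambda)
    show "continuous_on UNIV (\<lambda>z :: real \<times> real. if i = 1 then fst z else snd z)" for i :: 2
      by (cases "i = 1") (auto intro!: continuous_intros)
  qed
qed

text \<open>Identifies Lebesgue measure on vectors indexed by \<open>2\<close> with a product measure, so that Tonelli's
theorem for pairs applies to planar bodies.\<close>

lemma lborel_plane_eq_distr:
  "(lborel :: (real ^ 2) measure) = distr (lborel \<Otimes>\<^sub>M lborel) borel (\<lambda>z. pt (fst z) (snd z))"
proof (rule lborel_eqI)
  have meas: "(\<lambda>z. pt (fst z) (snd z)) \<in> borel_measurable (lborel \<Otimes>\<^sub>M lborel)"
    using borel_measurable_continuous_onI[OF pt_continuous] by (simp add: lborel_prod)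
  fix l u :: "real^2"
  assume le: "\<And>b. b \<in> Basis \<Longrightarrow> l \<bullet> b \<le> u \<bullet> b"
  have le': "l $ i \<le> u $ i" for i using le[of "axis i 1"] by (simp add: axis_in_Basis_iff inner_axis)
  have "emeasure (distr (lborel \<Otimes>\<^sub>M lborel) borel (\<lambda>z. pt (fst z) (snd z))) (box l u)
     = emeasure (lborel \<Otimes>\<^sub>M lborel) ((\<lambda>z. pt (fst z) (snd z)) -` box l u \<inter> space (lborel \<Otimes>\<^sub>M lborel))"
    by (rule emeasure_distr[OF meas]) simp
  also have "(\<lambda>z. pt (fst z) (snd z)) -` box l u \<inter> space (lborel \<Otimes>\<^sub>M lborel)
      = {l $ 1 <..< u $ 1} \<times> {l $ 2 <..< u $ 2}"
    by (auto simp: mem_box_cart forall_2 space_pair_measure)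
  also have "emeasure (lborel \<Otimes>\<^sub>M lborel) \<dots> = ennreal (u $ 1 - l $ 1) * ennreal (u $ 2 - l $ 2)"
    using le' by (subst lborel.emeasure_pair_measure_Times) auto
  also have "\<dots> = ennreal (\<Prod>b\<in>Basis. (u - l) \<bullet> b)"
  proof -
    have "(\<Prod>b\<in>Basis. (u - l) \<bullet> b) = (u $ 1 - l $ 1) * (u $ 2 - l $ 2)"
    proof -
      have B: "(Basis :: (real^2) set) = (\<lambda>i. axis i 1) ` UNIV" by (auto simp: Basis_vec_def)
      have "inj (\<lambda>i :: 2. axis i (1::real))" by (auto simp: inj_on_def axis_eq_axis)
      then show ?thesis unfolding B
        by (simp add: prod.reindex UNIV_2 inner_axis)
    qed
    then show ?thesis using le' by (simp add: ennreal_mult')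
  qed
  finally show "emeasure (distr (lborel \<Otimes>\<^sub>M lborel) borel (\<lambda>z. pt (fst z) (snd z))) (box l u)
     = (\<Prod>b\<in>Basis. (u - l) \<bullet> b)" .
qed simp

lemma emeasure_plane_by_slices:
  fixes L :: "(real ^ 2) set"
  assumes "L \<in> sets borel"
  shows "emeasure lborel L = (\<integral>\<^sup>+x. emeasure lborel {y. pt x y \<in> L} \<partial>lborel)"
proof -
  have meas: "(\<lambda>z. pt (fst z) (snd z)) \<in> borel_measurable (lborel \<Otimes>\<^sub>M lborel)"
    using borel_measurable_continuous_onI[OF pt_continuous] by (simp add: lborel_prod)
  let ?S = "(\<lambda>z. pt (fst z) (snd z)) -` L \<inter> space (lborel \<Otimes>\<^sub>M lborel)"
  have "emeasure lborel L = emeasure (lborel \<Otimes>\<^sub>M lborel) ?S"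
    by (subst lborel_plane_eq_distr, rule emeasure_distr[OF meas assms])
  also have "\<dots> = (\<integral>\<^sup>+x. emeasure lborel (Pair x -` ?S) \<partial>lborel)"
    by (rule lborel.emeasure_pair_measure_alt) (rule measurable_sets[OF meas assms])
  also have "\<dots> = (\<integral>\<^sup>+x. emeasure lborel {y. pt x y \<in> L} \<partial>lborel)"
    by (intro nn_integral_cong arg_cong[where f = "emeasure lborel"]) (auto simp: space_pair_measure)
  finally show ?thesis .
qed

lemma measure_pos_of_interior:
  fixes S :: "'a::euclidean_space set"
  assumes "x \<in> interior S" "compact S"
  shows "0 < measure lebesgue S"
proof -
  obtain e where e: "e > 0" "ball x e \<subseteq> S" using assms(1) mem_interior by blast
  have "measure lebesgue (ball x e) \<le> measure lebesgue S"
    using e assms(2) by (intro measure_mono_fmeasurable lmeasurable_compact) auto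
  moreover have "0 < measure lebesgue (ball x e)"
    using e(1) by (simp add: content_ball_pos)
  ultimately show ?thesis by linarith
qed

text \<open>The role of \<open>L\<close> is played by the polar body of \<open>K\<close>. It is described by its \<open>half_width\<close> along
the first axis and the function \<open>upper\<close> that bounds it from above; by symmetry the lower boundary is
\<open>x \<mapsto> - upper (- x)\<close>.\<close>

locale symmetric_planar_body =
  fixes L :: "(real ^ 2) set"
  assumes compact: "compact L" and convex: "convex L"
    and symmetric: "v \<in> L \<Longrightarrow> - v \<in> L"
    and interior: "0 \<in> interior L"
begin

definition half_width :: real where "half_width = Sup ((\<lambda>v. v $ 1) ` L)"

definition upper :: "real \<Rightarrow> real" where "upper x = Sup {y. pt x y \<in> L}"

lemma zero_in: "0 \<in> L" using interior interior_subset by blast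

lemma bounded_components:
  obtains C where "\<And>v i. v \<in> L \<Longrightarrow> \<bar>v $ i\<bar> \<le> C"
proof -
  obtain C where "\<And>v. v \<in> L \<Longrightarrow> norm v \<le> C"
    using compact_imp_bounded[OF compact] by (auto simp: bounded_iff)
  then show ?thesis using that component_le_norm_cart order_trans by blast
qed

lemma abscissa_le_width: "v \<in> L \<Longrightarrow> \<bar>v $ 1\<bar> \<le> half_width"
proof -
  have "v $ 1 \<le> half_width" if "v \<in> L" for v
  proof -
    obtain C where "\<And>v. v \<in> L \<Longrightarrow> \<bar>v $ 1\<bar> \<le> C" using bounded_components by metis
    then have "bdd_above ((\<lambda>v. v $ 1) ` L)" by (intro bdd_aboveI[of _ C]) (auto simp: abs_le_iff)
    then show ?thesis using that unfolding half_width_def by (intro cSup_upper) auto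
  qed
  from this[of v] this[of "- v"] show "v \<in> L \<Longrightarrow> \<bar>v $ 1\<bar> \<le> half_width" using symmetric[of v] by auto
qed

lemma half_width_attained: obtains s where "pt half_width s \<in> L"
proof -
  have "continuous_on L (\<lambda>v. v $ 1)" by (intro continuous_intros)
  then obtain v where v: "v \<in> L" "\<And>u. u \<in> L \<Longrightarrow> u $ 1 \<le> v $ 1"
    using continuous_attains_sup[OF compact, of "\<lambda>v. v $ 1"] zero_in by auto
  then have "half_width = v $ 1" unfolding half_width_def by (intro cSup_eq_maximum) auto
  then show ?thesis using that[of "v $ 2"] v(1) pt_components[of v] by simp
qed

lemma half_width_pos: "0 < half_width"
proof -
  obtain e where e: "e > 0" "cball 0 e \<subseteq> L" using interior by (meson mem_interior_cball)
  have "norm (e *\<^sub>R axis 1 1 :: real^2) \<le> e" using e(1) by simp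
  then have "e *\<^sub>R axis 1 1 \<in> L" using e(2) by auto
  from abscissa_le_width[OF this] show ?thesis using e by (simp add: axis_def)
qed

lemma slice_compact: "compact {y. pt x y \<in> L}"
proof -
  have "continuous_on UNIV (\<lambda>y. pt x y)"
  proof -
    have "continuous_on UNIV (\<lambda>y :: real. (x, y))" by (intro continuous_intros)
    from continuous_on_compose2[OF pt_continuous this] show ?thesis by simp
  qed
  then have "closed ((\<lambda>y. pt x y) -` L)" by (rule closed_vimage[OF compact_imp_closed[OF compact]])
  moreover have "bounded {y. pt x y \<in> L}"
  proof -
    obtain C where "\<And>v i. v \<in> L \<Longrightarrow> \<bar>v $ i\<bar> \<le> C" using bounded_components by metis
    then have "norm y \<le> C" if "pt x y \<in> L" for y using that by (force dest: spec[of _ 2])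
    then show ?thesis by (intro boundedI) auto
  qed
  ultimately show ?thesis by (simp add: compact_eq_bounded_closed vimage_def)
qed

lemma slice_nonempty: "\<bar>x\<bar> \<le> half_width \<Longrightarrow> {y. pt x y \<in> L} \<noteq> {}"
proof -
  assume x: "\<bar>x\<bar> \<le> half_width"
  obtain s where s: "pt half_width s \<in> L" using half_width_attained .
  define t where "t = (1 + x / half_width) / 2"
  have t: "0 \<le> t" "t \<le> 1" using x half_width_pos by (auto simp: t_def field_simps abs_le_iff)
  have "t *\<^sub>R pt half_width s + (1 - t) *\<^sub>R (- pt half_width s) \<in> L"
    using convexD[OF convex s symmetric[OF s], of t "1 - t"] t by auto
  moreover have "t *\<^sub>R pt half_width s + (1 - t) *\<^sub>R (- pt half_width s) = pt x ((2 * t - 1) * s)"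
    using half_width_pos by (simp add: vec_eq_iff forall_2 t_def field_simps)
  ultimately show ?thesis by auto
qed

lemma upper_in: "\<bar>x\<bar> \<le> half_width \<Longrightarrow> pt x (upper x) \<in> L"
  using closed_contains_Sup[OF slice_nonempty bounded_imp_bdd_above compact_imp_closed[OF slice_compact]]
    compact_imp_bounded[OF slice_compact] unfolding upper_def by blast

lemma le_upper: "pt x y \<in> L \<Longrightarrow> y \<le> upper x"
  unfolding upper_def
  by (intro cSup_upper bounded_imp_bdd_above compact_imp_bounded slice_compact) auto

lemma mem_iff: "pt x y \<in> L \<longleftrightarrow> \<bar>x\<bar> \<le> half_width \<and> - upper (- x) \<le> y \<and> y \<le> upper x"
proof
  assume L: "pt x y \<in> L"
  have "- pt x y = pt (-x) (-y)" by (simp add: vec_eq_iff forall_2)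
  then have "pt (-x) (-y) \<in> L" using symmetric[OF L] by simp
  from le_upper[OF this] le_upper[OF L] abscissa_le_width[OF L]
  show "\<bar>x\<bar> \<le> half_width \<and> - upper (- x) \<le> y \<and> y \<le> upper x" by simp
next
  assume xy: "\<bar>x\<bar> \<le> half_width \<and> - upper (- x) \<le> y \<and> y \<le> upper x"
  have "- pt (-x) (upper (-x)) = pt x (- upper (-x))" by (simp add: vec_eq_iff forall_2)
  then have lo: "pt x (- upper (- x)) \<in> L" using symmetric[OF upper_in[of "-x"]] xy by simp
  have hi: "pt x (upper x) \<in> L" using upper_in xy by simp
  have "y \<in> closed_segment (- upper (- x)) (upper x)" using xy by (simp add: closed_segment_eq_real_ivl)
  then obtain t where t: "0 \<le> t" "t \<le> 1" "y = (1 - t) *\<^sub>R (- upper (- x)) + t *\<^sub>R upper x"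
    unfolding closed_segment_def by blast
  have "(1 - t) *\<^sub>R pt x (- upper (- x)) + t *\<^sub>R pt x (upper x) \<in> L"
    using convexD[OF convex lo hi, of "1 - t" t] t by simp
  moreover have "(1 - t) *\<^sub>R pt x (- upper (- x)) + t *\<^sub>R pt x (upper x) = pt x y"
  proof -
    have "(1 - t) * x + t * x = x" "(1 - t) * (- upper (- x)) + t * upper x = y"
      using t(3) by (simp_all add: algebra_simps)
    then show ?thesis unfolding pt_combination by presburger
  qed
  ultimately show "pt x y \<in> L" by simp
qed

lemma upper_plus_reflected_nonneg: "\<bar>x\<bar> \<le> half_width \<Longrightarrow> 0 \<le> upper x + upper (- x)"
  using mem_iff[of x "upper x"] upper_in[of x] by auto

lemma upper_bounded: obtains C where "\<And>x. \<bar>x\<bar> \<le> half_width \<Longrightarrow> \<bar>upper x\<bar> \<le> C"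
proof -
  obtain C where C: "\<And>v i. v \<in> L \<Longrightarrow> \<bar>v $ i\<bar> \<le> C" using bounded_components by metis
  show ?thesis by (rule that[of C]) (use C[OF upper_in, of _ 2] in simp)
qed

lemma upper_continuous: "continuous_on {-half_width<..<half_width} upper"
proof -
  have "convex_on {-half_width<..<half_width} (\<lambda>x. - upper x)"
  proof (rule convex_onI)
    fix t x y :: real assume t: "0 < t" "t < 1" and x: "x \<in> {-half_width<..<half_width}" and y: "y \<in> {-half_width<..<half_width}"
    have "(1 - t) *\<^sub>R pt x (upper x) + t *\<^sub>R pt y (upper y) \<in> L"
      using convexD[OF convex upper_in[of x] upper_in[of y], of "1 - t" t] t x y by (simp add: abs_less_iff abs_le_iff)
    then have "pt ((1 - t) * x + t * y) ((1 - t) * upper x + t * upper y) \<in> L"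
      by (simp add: pt_combination)
    from le_upper[OF this] show "- upper ((1 - t) *\<^sub>R x + t *\<^sub>R y) \<le> (1 - t) * - upper x + t * - upper y"
      by (simp add: algebra_simps)
  qed simp
  then have "continuous_on {-half_width<..<half_width} (\<lambda>x. - upper x)"
    by (intro convex_on_continuous) auto
  then have "continuous_on {-half_width<..<half_width} (\<lambda>x. - (- upper x))" by (rule continuous_on_minus)
  then show ?thesis by simp
qed

lemma upper_set_integrable: "set_integrable lborel {-half_width<..<half_width} upper"
proof -
  obtain C where C: "\<And>x. \<bar>x\<bar> \<le> half_width \<Longrightarrow> \<bar>upper x\<bar> \<le> C" using upper_bounded by blast
  have m: "(\<lambda>x. indicator {-half_width<..<half_width} x *\<^sub>R upper x) \<in> borel_measurable borel"
    by (rule borel_measurable_continuous_on_indicator) (auto intro: upper_continuous)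
  show ?thesis unfolding set_integrable_def
  proof (rule integrableI_bounded_set[where A = "{-half_width<..<half_width}" and B = C])
    show "AE x in lborel. x \<in> {-half_width<..<half_width} \<longrightarrow>
        norm (indicator {-half_width<..<half_width} x *\<^sub>R upper x) \<le> C"
      using C by (intro AE_I2) auto
  qed (use m half_width_pos in auto)
qed

lemma upper_absolutely_integrable: "upper absolutely_integrable_on {-half_width<..<half_width}"
  using upper_set_integrable unfolding set_integrable_def absolutely_integrable_on_def
  by (simp add: integrable_completion set_integrable_def)

lemma area_eq_integral: "measure lebesgue L = 2 * integral {-half_width<..<half_width} upper"
proof -
  let ?S = "{-half_width<..<half_width}"
  define F where "F x = upper x + upper (- x)" for x
  have refl_has: "((\<lambda>x. upper (- x)) has_integral integral ?S upper) ?S"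
  proof -
    have "(upper has_integral integral ?S upper) ?S"
      using set_borel_integral_eq_integral(1)[OF upper_set_integrable] by (simp add: has_integral_integral)
    then have "(upper has_integral integral ?S upper) {-half_width..half_width}"
      using has_integral_Icc_iff_Ioo by blast
    from has_integral_reflect_lemma_real[OF this]
    have "((\<lambda>x. upper (- x)) has_integral integral ?S upper) {-half_width..half_width}" by simp
    then show ?thesis using has_integral_Icc_iff_Ioo by blast
  qed
  have refl: "set_integrable lborel ?S (\<lambda>x. upper (- x))"
  proof -
    have "integrable lborel (\<lambda>x. indicator ?S (0 + (-1) * x) *\<^sub>R upper (0 + (-1) * x))"
      using upper_set_integrable unfolding set_integrable_def
      by (intro lborel_integrable_real_affine) auto
    moreover have "indicator ?S (- x) = (indicator ?S x :: real)" for x by (auto simp: indicator_def)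
    ultimately show ?thesis by (simp add: set_integrable_def)
  qed
  have F: "set_integrable lborel ?S F"
    unfolding F_def using upper_set_integrable refl by (rule set_integral_add)
  have "emeasure lborel L = (\<integral>\<^sup>+x. emeasure lborel {y. pt x y \<in> L} \<partial>lborel)"
    by (rule emeasure_plane_by_slices) (simp add: compact borel_compact)
  also have "\<dots> = (\<integral>\<^sup>+x. ennreal (indicator ?S x *\<^sub>R F x) \<partial>lborel)"
  proof (rule nn_integral_cong_AE)
    have "AE x in lborel. x \<noteq> half_width \<and> x \<noteq> - half_width"
      using AE_lborel_singleton[of half_width] AE_lborel_singleton[of "- half_width"] by eventually_elim auto
    then show "AE x in lborel. emeasure lborel {y. pt x y \<in> L} = ennreal (indicator ?S x *\<^sub>R F x)"
    proof eventually_elim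
      fix x assume x: "x \<noteq> half_width \<and> x \<noteq> - half_width"
      show "emeasure lborel {y. pt x y \<in> L} = ennreal (indicator ?S x *\<^sub>R F x)"
      proof (cases "\<bar>x\<bar> \<le> half_width")
        case True
        then have "{y. pt x y \<in> L} = {- upper (- x) .. upper x}" by (auto simp: mem_iff)
        then show ?thesis using True x upper_plus_reflected_nonneg[OF True] by (auto simp: F_def abs_le_iff)
      next
        case False
        then have "{y. pt x y \<in> L} = {}" by (auto simp: mem_iff)
        then show ?thesis using False by (auto simp: indicator_def)
      qed
    qed
  qed
  also have "\<dots> = ennreal (\<integral>x. indicator ?S x *\<^sub>R F x \<partial>lborel)"
  proof (rule nn_integral_eq_integral)
    show "AE x in lborel. 0 \<le> indicator ?S x *\<^sub>R F x"
      using upper_plus_reflected_nonneg by (intro AE_I2) (auto simp: F_def indicator_def)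
  qed (use F in \<open>simp add: set_integrable_def\<close>)
  finally have em: "emeasure lborel L = ennreal (\<integral>x. indicator ?S x *\<^sub>R F x \<partial>lborel)" .
  have nn: "0 \<le> (\<integral>x. indicator ?S x *\<^sub>R F x \<partial>lborel)"
    using upper_plus_reflected_nonneg by (intro Bochner_Integration.integral_nonneg) (auto simp: F_def indicator_def)
  have "measure lebesgue L = measure lborel L"
    by (simp add: compact borel_compact)
  also have "\<dots> = (\<integral>x. indicator ?S x *\<^sub>R F x \<partial>lborel)"
    using em nn by (simp add: measure_def)
  also have "\<dots> = integral ?S F"
    using set_borel_integral_eq_integral(2)[OF F] by (simp add: set_lebesgue_integral_def)
  also have "\<dots> = integral ?S upper + integral ?S (\<lambda>x. upper (- x))"
    unfolding F_def
    by (rule Henstock_Kurzweil_Integration.integral_add)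
      (use set_borel_integral_eq_integral(1)[OF upper_set_integrable] refl_has in auto)
  also have "integral ?S (\<lambda>x. upper (- x)) = integral ?S upper" using refl_has by (rule integral_unique)
  finally show ?thesis by simp
qed

end

lemma det2_pt: "det2 (pt x y) (pt x' y') = x * y' - y * x'"
  by (simp add: det2_def)

section \<open>The mean area of inscribed hexagons\<close>

lemma eq_mean_of_le_mean:
  fixes S :: "real \<Rightarrow> real"
  assumes int: "(S has_integral (b - a) * M) {a..b}" and cont: "continuous_on {a<..<b} S"
    and le: "\<And>x. x \<in> {a<..<b} \<Longrightarrow> S x \<le> M" and x: "x \<in> {a<..<b}"
  shows "S x = M"
proof -
  define D where "D t = (if t \<in> {a<..<b} then M - S t else 0)" for t
  have "((\<lambda>t. M - S t) has_integral (b - a) * M - (b - a) * M) {a..b}"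
    using x by (intro has_integral_diff[OF _ int] has_integral_const_real[of M a b, THEN has_integral_eq_rhs]) auto
  then have "((\<lambda>t. M - S t) has_integral 0) {a<..<b}"
    using has_integral_Icc_iff_Ioo by fastforce
  then have "(D has_integral 0) {a<..<b}"
    by (rule has_integral_eq[rotated]) (simp add: D_def)
  then have D: "(D has_integral 0) {a..b}" by (simp add: has_integral_Icc_iff_Ioo)
  have D0: "0 \<le> D t" for t using le by (auto simp: D_def)
  \<comment> \<open>The function is continuous only on the open interval, so the comparison takes place on a closed subinterval around the given point.\<close>
  define c d where "c = (a + x) / 2" and "d = (x + b) / 2"
  have cd: "a < c" "c < x" "x < d" "d < b" using x by (auto simp: c_def d_def)
  have contD: "continuous_on {c..d} D"
  proof (rule continuous_on_eq)
    show "continuous_on {c..d} (\<lambda>t. M - S t)"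
      using cd by (intro continuous_intros continuous_on_subset[OF cont]) auto
  qed (use cd in \<open>auto simp: D_def\<close>)
  have "integral {c..d} D \<le> integral {a..b} D"
    using cd D D0 integrable_continuous_real[OF contD] by (intro integral_subset_le) auto
  moreover have "integral {a..b} D = 0" using D by (rule integral_unique)
  moreover have "0 \<le> integral {c..d} D"
    using D0 by (intro Henstock_Kurzweil_Integration.integral_nonneg integrable_continuous_real contD) auto
  ultimately have "(D has_integral 0) (cbox c d)"
    using integrable_integral[OF integrable_continuous_real[OF contD]] by simp
  then have "D x = 0"
    using cd D0 contD by (intro has_integral_0_cbox_imp_0[of c d D]) (auto simp: box_real)
  then show ?thesis using x by (simp add: D_def)
qed

context symmetric_planar_body
begin

definition boundary_point :: "real \<Rightarrow> real ^ 2" where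
  "boundary_point \<theta> = pt (half_width * cos \<theta>) (upper (half_width * cos \<theta>))"

lemma abscissa_bound: "\<bar>half_width * cos \<theta>\<bar> \<le> half_width"
  using half_width_pos abs_cos_le_one[of \<theta>] by (simp add: abs_mult mult_left_le)

lemma boundary_point_in: "boundary_point \<theta> \<in> L"
  unfolding boundary_point_def by (rule upper_in) (rule abscissa_bound)

lemma cos_strictly_between: "\<theta> \<in> {0<..<pi} \<Longrightarrow> half_width * cos \<theta> \<in> {-half_width<..<half_width}"
proof -
  assume "\<theta> \<in> {0<..<pi}"
  then have "cos \<theta> < cos 0" "cos pi < cos \<theta>" by (intro cos_monotone_0_pi; simp)+
  then have "half_width * cos \<theta> < half_width * 1" "half_width * (-1) < half_width * cos \<theta>"
    using half_width_pos by (intro mult_strict_left_mono; simp)+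
  then show ?thesis by simp
qed

lemma upper_cos_continuous: "continuous_on {0<..<pi} (\<lambda>\<theta>. upper (half_width * cos \<theta>))"
  by (rule continuous_on_compose2[OF upper_continuous]) (use cos_strictly_between in \<open>auto intro!: continuous_intros\<close>)

lemma abscissa_image: "(\<lambda>\<theta>. half_width * cos \<theta>) ` {0<..<pi} = {-half_width<..<half_width}"
proof
  show "(\<lambda>\<theta>. half_width * cos \<theta>) ` {0<..<pi} \<subseteq> {-half_width<..<half_width}" using cos_strictly_between by auto
  show "{-half_width<..<half_width} \<subseteq> (\<lambda>\<theta>. half_width * cos \<theta>) ` {0<..<pi}"
  proof
    fix x assume "x \<in> {-half_width<..<half_width}"
    then have b: "-1 < x / half_width" "x / half_width < 1" using half_width_pos by (auto simp: field_simps)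
    then have "0 < arccos (x / half_width)" "arccos (x / half_width) < pi" using arccos_lt_bounded by auto
    moreover have "x = half_width * cos (arccos (x / half_width))" using b half_width_pos by (simp add: cos_arccos)
    ultimately show "x \<in> (\<lambda>\<theta>. half_width * cos \<theta>) ` {0<..<pi}" by (intro image_eqI) auto
  qed
qed

text \<open>The substitution \<open>x = half_width * cos \<theta>\<close> in the integral of \<open>upper\<close>. It is carried out on the open
interval, where the change-of-variables theorem needs no continuity at the ends.\<close>

lemma half_area_polar_integral:
  "((\<lambda>\<theta>. half_width * sin \<theta> * upper (half_width * cos \<theta>)) has_integral measure lebesgue L / 2) {0..pi}"
proof -
  have inj: "inj_on (\<lambda>\<theta>. half_width * cos \<theta>) {0<..<pi}"
    using half_width_pos by (auto simp: inj_on_def intro: cos_inj_pi)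
  have "(\<lambda>\<theta>. \<bar>- (half_width * sin \<theta>)\<bar> * upper (half_width * cos \<theta>)) absolutely_integrable_on {0<..<pi} \<and>
      integral {0<..<pi} (\<lambda>\<theta>. \<bar>- (half_width * sin \<theta>)\<bar> * upper (half_width * cos \<theta>)) = measure lebesgue L / 2"
    by (rule has_absolute_integral_change_of_variables_1'[THEN iffD2])
      (use upper_absolutely_integrable area_eq_integral inj in
        \<open>auto simp: abscissa_image intro!: derivative_eq_intros\<close>)
  then have "((\<lambda>\<theta>. \<bar>- (half_width * sin \<theta>)\<bar> * upper (half_width * cos \<theta>)) has_integral measure lebesgue L / 2) {0<..<pi}"
    using set_lebesgue_integral_eq_integral(1) by (auto simp: has_integral_iff)
  then have "((\<lambda>\<theta>. half_width * sin \<theta> * upper (half_width * cos \<theta>)) has_integral measure lebesgue L / 2) {0<..<pi}"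
    by (rule has_integral_eq[rotated]) (use half_width_pos in \<open>auto simp: abs_mult sin_gt_zero less_imp_le\<close>)
  then show ?thesis by (simp add: has_integral_Icc_iff_Ioo)
qed

text \<open>Each determinant is the area of two opposite triangles with apex \<open>0\<close>, so the sum is the area of the
symmetric hexagon spanned by the three boundary points.\<close>

definition hexagon_area :: "real \<Rightarrow> real" where
  "hexagon_area \<theta> = det2 (boundary_point \<theta>) (boundary_point (\<theta> + pi / 3))
     + det2 (boundary_point (\<theta> + pi / 3)) (boundary_point (\<theta> + 2 * pi / 3))
     + det2 (boundary_point \<theta>) (boundary_point (\<theta> + 2 * pi / 3))"

lemma third_turns:
  "cos (\<theta> + pi / 3) = cos \<theta> / 2 - sqrt 3 / 2 * sin \<theta>"
  "sin (\<theta> + pi / 3) = sin \<theta> / 2 + sqrt 3 / 2 * cos \<theta>"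
  "cos (\<theta> + 2 * pi / 3) = - cos \<theta> / 2 - sqrt 3 / 2 * sin \<theta>"
  "sin (\<theta> + 2 * pi / 3) = - sin \<theta> / 2 + sqrt 3 / 2 * cos \<theta>"
proof -
  show 1: "cos (\<theta> + pi / 3) = cos \<theta> / 2 - sqrt 3 / 2 * sin \<theta>" for \<theta>
    by (simp add: cos_add cos_60 sin_60)
  show 2: "sin (\<theta> + pi / 3) = sin \<theta> / 2 + sqrt 3 / 2 * cos \<theta>" for \<theta>
    by (simp add: sin_add cos_60 sin_60)
  have e: "\<theta> + 2 * pi / 3 = (\<theta> + pi / 3) + pi / 3" by simp
  show "cos (\<theta> + 2 * pi / 3) = - cos \<theta> / 2 - sqrt 3 / 2 * sin \<theta>"
    unfolding e 1[of "\<theta> + pi/3"] 1[of \<theta>] 2 by (simp add: field_simps)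
  show "sin (\<theta> + 2 * pi / 3) = - sin \<theta> / 2 + sqrt 3 / 2 * cos \<theta>"
    unfolding e 2[of "\<theta> + pi/3"] 1 2[of \<theta>] by (simp add: field_simps)
qed

text \<open>Collecting the terms by ordinates, the coefficient of each ordinate is a sum or difference of the
cosines of the other two angles, which is \<open>\<surd>3\<close> times the sine of its own angle. So the area splits
into contributions of the separate vertices.\<close>

lemma hexagon_area_eq:
  "hexagon_area \<theta> = sqrt 3 * (half_width * sin \<theta> * upper (half_width * cos \<theta>)
     + half_width * sin (\<theta> + pi / 3) * upper (half_width * cos (\<theta> + pi / 3))
     + half_width * sin (\<theta> + 2 * pi / 3) * upper (half_width * cos (\<theta> + 2 * pi / 3)))"
proof -
  have rearrange: "w * c0 * y1 - y0 * (w * c1) + (w * c1 * y2 - y1 * (w * c2)) + (w * c0 * y2 - y0 * (w * c2))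
      = w * (y0 * (- c1 - c2) + y1 * (c0 - c2) + y2 * (c0 + c1))" for w c0 c1 c2 y0 y1 y2 :: real
    by (simp add: algebra_simps)
  have "- cos (\<theta> + pi / 3) - cos (\<theta> + 2 * pi / 3) = sqrt 3 * sin \<theta>"
    "cos \<theta> - cos (\<theta> + 2 * pi / 3) = sqrt 3 * sin (\<theta> + pi / 3)"
    "cos \<theta> + cos (\<theta> + pi / 3) = sqrt 3 * sin (\<theta> + 2 * pi / 3)"
    unfolding third_turns by (simp_all add: field_simps)
  then show ?thesis
    unfolding hexagon_area_def boundary_point_def det2_pt rearrange by (simp add: algebra_simps)
qed

definition mean_hexagon_area :: real where
  "mean_hexagon_area = 3 * sqrt 3 / (2 * pi) * measure lebesgue L"

text \<open>As \<open>\<theta>\<close> runs through \<open>[0, \<pi>/3]\<close>, the three vertices together run once through the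
upper boundary, so the three contributions add up to the integral over \<open>[0, \<pi>]\<close>.\<close>

lemma hexagon_area_integral:
  "(hexagon_area has_integral (pi / 3 - 0) * mean_hexagon_area) {0..pi / 3}"
proof -
  let ?G = "\<lambda>\<theta>. half_width * sin \<theta> * upper (half_width * cos \<theta>)"
  have int: "?G integrable_on {0..pi}" using half_area_polar_integral by blast
  have sub: "(?G has_integral integral {a..b} ?G) {a..b}" if "0 \<le> a" "b \<le> pi" for a b
    using integrable_subinterval_real[OF int, of a b] that by (auto simp: has_integral_integral)
  have h0: "(?G has_integral integral {0..pi/3} ?G) {0..pi/3}" by (rule sub) auto
  have "(?G has_integral integral {pi/3..2*pi/3} ?G) {pi/3..2*pi/3}" by (rule sub) auto
  from has_integral_shift_real_ivl[OF this, of "pi/3"]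
  have h1: "((\<lambda>\<theta>. ?G (\<theta> + pi/3)) has_integral integral {pi/3..2*pi/3} ?G) {0..pi/3}" by simp
  have "(?G has_integral integral {2*pi/3..pi} ?G) {2*pi/3..pi}" by (rule sub) auto
  from has_integral_shift_real_ivl[OF this, of "2*pi/3"]
  have h2: "((\<lambda>\<theta>. ?G (\<theta> + 2*pi/3)) has_integral integral {2*pi/3..pi} ?G) {0..pi/3}" by simp
  have "integral {0..pi/3} ?G + integral {pi/3..pi} ?G = integral {0..pi} ?G"
    by (rule Henstock_Kurzweil_Integration.integral_combine[OF _ _ int]) auto
  moreover have "integral {pi/3..2*pi/3} ?G + integral {2*pi/3..pi} ?G = integral {pi/3..pi} ?G"
    by (rule Henstock_Kurzweil_Integration.integral_combine[OF _ _ integrable_subinterval_real[OF int]]) auto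
  moreover have "integral {0..pi} ?G = measure lebesgue L / 2"
    using half_area_polar_integral by (rule integral_unique)
  ultimately have total: "integral {0..pi/3} ?G + integral {pi/3..2*pi/3} ?G + integral {2*pi/3..pi} ?G
      = measure lebesgue L / 2" by simp
  have "((\<lambda>\<theta>. sqrt 3 * (?G \<theta> + ?G (\<theta> + pi/3) + ?G (\<theta> + 2*pi/3))) has_integral
      sqrt 3 * (measure lebesgue L / 2)) {0..pi/3}"
    using has_integral_mult_right[OF has_integral_add[OF has_integral_add[OF h0 h1] h2], of "sqrt 3"]
    unfolding total .
  moreover have "(pi / 3 - 0) * mean_hexagon_area = sqrt 3 * (measure lebesgue L / 2)"
    by (simp add: mean_hexagon_area_def)
  moreover have "hexagon_area = (\<lambda>\<theta>. sqrt 3 * (?G \<theta> + ?G (\<theta> + pi/3) + ?G (\<theta> + 2*pi/3)))"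
    using hexagon_area_eq by (intro ext) simp
  ultimately show ?thesis by metis
qed

lemma hexagon_area_continuous: "continuous_on {0<..<pi / 3} hexagon_area"
proof -
  have "continuous_on {0<..<pi / 3} (\<lambda>\<theta>. upper (half_width * cos (\<theta> + c)))" if "0 \<le> c" "c \<le> 2 * pi / 3" for c
    by (rule continuous_on_compose2[OF upper_cos_continuous]) (use that in \<open>auto intro!: continuous_intros\<close>)
  from this[of 0] this[of "pi / 3"] this[of "2 * pi / 3"]
  have "continuous_on {0<..<pi / 3} (\<lambda>\<theta>. sqrt 3 * (half_width * sin \<theta> * upper (half_width * cos \<theta>)
     + half_width * sin (\<theta> + pi / 3) * upper (half_width * cos (\<theta> + pi / 3))
     + half_width * sin (\<theta> + 2 * pi / 3) * upper (half_width * cos (\<theta> + 2 * pi / 3))))"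
    by (intro continuous_intros) auto
  then show ?thesis using hexagon_area_eq by (metis (no_types, lifting) continuous_on_cong)
qed

lemma hexagon_area_dichotomy:
  "(\<exists>\<theta>\<in>{0<..<pi / 3}. mean_hexagon_area < hexagon_area \<theta>) \<or>
   (\<forall>\<theta>\<in>{0<..<pi / 3}. hexagon_area \<theta> = mean_hexagon_area)"
  using eq_mean_of_le_mean[OF hexagon_area_integral hexagon_area_continuous] by force

lemma area_pos: "0 < measure lebesgue L"
  using measure_pos_of_interior[OF interior compact] .

lemma mean_hexagon_area_pos: "0 < mean_hexagon_area"
  using area_pos by (simp add: mean_hexagon_area_def)

end

section \<open>Bodies without hexagons above the mean\<close>

lemma constant_of_quadratic_increments:
  fixes h :: "real \<Rightarrow> real"
  assumes "\<And>x. x \<in> {a<..<b} \<Longrightarrow> \<exists>C. \<forall>\<^sub>F y in at x. \<bar>h y - h x\<bar> \<le> C * (y - x)\<^sup>2"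
  obtains c where "\<And>x. x \<in> {a<..<b} \<Longrightarrow> h x = c"
proof -
  have der: "(h has_field_derivative 0) (at x)" if x: "x \<in> {a<..<b}" for x
  proof -
    obtain C where C: "\<forall>\<^sub>F y in at x. \<bar>h y - h x\<bar> \<le> C * (y - x)\<^sup>2" using assms[OF x] by blast
    have "((\<lambda>y. (h y - h x) / (y - x)) \<longlongrightarrow> 0) (at x)"
    proof (rule Lim_null_comparison)
      show "((\<lambda>y. C * \<bar>y - x\<bar>) \<longlongrightarrow> 0) (at x)" by (rule tendsto_eq_intros refl | simp)+
      show "\<forall>\<^sub>F y in at x. norm ((h y - h x) / (y - x)) \<le> C * \<bar>y - x\<bar>"
        using C eventually_neq_at_within[of x x UNIV]
      proof eventually_elim
        case (elim y)
        then have "\<bar>h y - h x\<bar> \<le> (C * \<bar>y - x\<bar>) * \<bar>y - x\<bar>" by (simp add: power2_eq_square abs_mult_self_eq mult.assoc)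
        then show ?case using elim by (simp add: divide_le_eq)
      qed
    qed
    then show ?thesis by (simp add: has_field_derivative_iff)
  qed
  have "\<exists>c. \<forall>x\<in>{a<..<b}. h x = c"
    by (rule has_field_derivative_zero_constant) (simp, rule has_field_derivative_at_within[OF der])
  then show ?thesis using that by blast
qed

lemma one_minus_cos_le: "1 - cos t \<le> t\<^sup>2 / 2" for t :: real
proof -
  have "1 - cos t = 2 * (sin (t / 2))\<^sup>2" using cos_double_sin[of "t / 2"] by simp
  also have "(sin (t / 2))\<^sup>2 \<le> (t / 2)\<^sup>2"
    using abs_sin_x_le_abs_x[of "t / 2"] unfolding abs_le_square_iff .
  finally show ?thesis by (simp add: power2_eq_square)
qed

text \<open>The situation forced by equality: no hexagon exceeds the mean area, and those that reach it have
equal triangles.\<close>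

locale extremal_planar_body = symmetric_planar_body +
  assumes hexagon_le: "\<And>a b c. a \<in> L \<Longrightarrow> b \<in> L \<Longrightarrow> c \<in> L \<Longrightarrow>
      det2 a b + det2 b c + det2 a c \<le> mean_hexagon_area"
    and hexagon_balanced: "\<And>a b c. a \<in> L \<Longrightarrow> b \<in> L \<Longrightarrow> c \<in> L \<Longrightarrow>
      det2 a b + det2 b c + det2 a c = mean_hexagon_area \<Longrightarrow>
      det2 a b = det2 b c \<and> det2 b c = det2 a c"
begin

text \<open>If \<open>L\<close> is an ellipse, its upper boundary is \<open>semiaxis * sin \<theta> + shear \<theta> * cos \<theta>\<close> over \<open>half_width * cos \<theta>\<close>
with constant \<open>shear\<close>. The value of \<open>semiaxis\<close> is the one for which a triangle with vertices \<open>0\<close> and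
two boundary points at angles differing by \<open>\<pi>/3\<close> has the sixth part of the mean hexagon area.\<close>

definition semiaxis :: real where
  "semiaxis = 2 * mean_hexagon_area / (3 * sqrt 3 * half_width)"

definition shear :: "real \<Rightarrow> real" where
  "shear \<theta> = (upper (half_width * cos \<theta>) - semiaxis * sin \<theta>) / cos \<theta>"

lemma semiaxis_pos: "0 < semiaxis"
  using mean_hexagon_area_pos half_width_pos by (simp add: semiaxis_def)

lemma cos_gt_half: "\<theta> \<in> {0<..<pi / 3} \<Longrightarrow> 1 / 2 < cos \<theta>"
  using cos_monotone_0_pi[of \<theta> "pi / 3"] by (simp add: cos_60)

lemma upper_first_third:
  assumes "\<theta> \<in> {0<..<pi / 3}"
  shows "upper (half_width * cos \<theta>) = semiaxis * sin \<theta> + shear \<theta> * cos \<theta>"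
  using cos_gt_half[OF assms] by (simp add: shear_def)

lemma hexagon_area_extremal:
  assumes "\<theta> \<in> {0<..<pi / 3}"
  shows "hexagon_area \<theta> = mean_hexagon_area"
proof -
  have "\<not> (\<exists>\<theta>\<in>{0<..<pi / 3}. mean_hexagon_area < hexagon_area \<theta>)"
    using hexagon_le[OF boundary_point_in boundary_point_in boundary_point_in]
    unfolding hexagon_area_def by (simp add: not_less)
  then show ?thesis using hexagon_area_dichotomy assms by blast
qed

lemma triangle_areas:
  assumes "\<theta> \<in> {0<..<pi / 3}"
  shows "det2 (boundary_point \<theta>) (boundary_point (\<theta> + pi / 3)) = mean_hexagon_area / 3"
    and "det2 (boundary_point \<theta>) (boundary_point (\<theta> + 2 * pi / 3)) = mean_hexagon_area / 3"
  using hexagon_balanced[OF boundary_point_in boundary_point_in boundary_point_in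
      hexagon_area_extremal[OF assms, unfolded hexagon_area_def]]
    hexagon_area_extremal[OF assms, unfolded hexagon_area_def] by linarith+

text \<open>The balanced areas are linear equations that determine the ordinates at \<open>\<theta> + \<pi>/3\<close> and \<open>\<theta> + 2\<pi>/3\<close>
from the one at \<open>\<theta>\<close>. Since the formula with \<open>shear \<theta>\<close> satisfies these equations, the same value
of the shear serves all three angles.\<close>

lemma upper_later_thirds:
  assumes \<theta>: "\<theta> \<in> {0<..<pi / 3}"
  shows "upper (half_width * cos (\<theta> + pi / 3)) = semiaxis * sin (\<theta> + pi / 3) + shear \<theta> * cos (\<theta> + pi / 3)"
    and "upper (half_width * cos (\<theta> + 2 * pi / 3)) =
      semiaxis * sin (\<theta> + 2 * pi / 3) + shear \<theta> * cos (\<theta> + 2 * pi / 3)"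
proof -
  have c: "0 < half_width * cos \<theta>" using cos_gt_half[OF \<theta>] half_width_pos by simp
  have \<kappa>: "mean_hexagon_area / 3 = half_width * semiaxis * (sqrt 3 / 2)"
    using half_width_pos by (simp add: semiaxis_def field_simps)
  have key: "upper (half_width * cos \<phi>) = semiaxis * sin \<phi> + shear \<theta> * cos \<phi>"
    if d: "det2 (boundary_point \<theta>) (boundary_point \<phi>) = mean_hexagon_area / 3"
      and s: "sin \<phi> * cos \<theta> - cos \<phi> * sin \<theta> = sqrt 3 / 2" for \<phi>
  proof -
    have "half_width * cos \<theta> * upper (half_width * cos \<phi>)
        = mean_hexagon_area / 3 + upper (half_width * cos \<theta>) * (half_width * cos \<phi>)"
      using d by (simp add: boundary_point_def det2_pt)
    also have "\<dots> = half_width * cos \<theta> * (semiaxis * sin \<phi> + shear \<theta> * cos \<phi>)"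
      unfolding \<kappa> s[symmetric] upper_first_third[OF \<theta>] by (simp add: algebra_simps)
    finally show ?thesis using c by (metis mult_cancel_left less_irrefl)
  qed
  have "sin (\<theta> + pi / 3) * cos \<theta> - cos (\<theta> + pi / 3) * sin \<theta> = sin (pi / 3)"
    using sin_diff[of "\<theta> + pi / 3" \<theta>] by simp
  then show "upper (half_width * cos (\<theta> + pi / 3)) = semiaxis * sin (\<theta> + pi / 3) + shear \<theta> * cos (\<theta> + pi / 3)"
    by (intro key triangle_areas \<theta>) (simp add: sin_60)
  have "sin (\<theta> + 2 * pi / 3) * cos \<theta> - cos (\<theta> + 2 * pi / 3) * sin \<theta> = sin (2 * pi / 3)"
    using sin_diff[of "\<theta> + 2 * pi / 3" \<theta>] by simp
  then show "upper (half_width * cos (\<theta> + 2 * pi / 3)) =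
      semiaxis * sin (\<theta> + 2 * pi / 3) + shear \<theta> * cos (\<theta> + 2 * pi / 3)"
    by (intro key triangle_areas \<theta>) (simp add: sin_120)
qed

text \<open>Replacing the first vertex of the extremal hexagon at \<open>\<theta>\<close> by the boundary point at \<open>\<phi>\<close> does not
enlarge the area. In the coordinates above this variation is
\<open>semiaxis * cos (\<phi> - \<theta>) + cos \<phi> * sin \<theta> * (shear \<phi> - shear \<theta>)\<close> up to a factor, with
value \<open>semiaxis\<close> at \<open>\<phi> = \<theta>\<close>.\<close>

lemma shear_increment:
  assumes \<theta>: "\<theta> \<in> {0<..<pi / 3}" and \<phi>: "\<phi> \<in> {0<..<pi / 3}"
  shows "cos \<phi> * sin \<theta> * (shear \<phi> - shear \<theta>) \<le> semiaxis * (1 - cos (\<phi> - \<theta>))"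
proof -
  let ?b = "boundary_point (\<theta> + pi / 3)" and ?c = "boundary_point (\<theta> + 2 * pi / 3)"
  define T where "T \<psi> = det2 (boundary_point \<psi>) ?b + det2 (boundary_point \<psi>) ?c" for \<psi>
  have "T \<phi> \<le> T \<theta>"
    using hexagon_le[OF boundary_point_in[of \<phi>] boundary_point_in boundary_point_in, of "\<theta> + pi / 3" "\<theta> + 2 * pi / 3"]
      hexagon_area_extremal[OF \<theta>] unfolding T_def hexagon_area_def by linarith
  moreover have "T \<psi> = half_width * sqrt 3 * (semiaxis * cos (\<psi> - \<theta>) + cos \<psi> * sin \<theta> * (shear \<psi> - shear \<theta>))"
    if "\<psi> \<in> {0<..<pi / 3}" for \<psi>
  proof -
    have "T \<psi> = half_width * (cos \<psi> * (upper (half_width * cos (\<theta> + pi / 3)) + upper (half_width * cos (\<theta> + 2 * pi / 3)))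
        - upper (half_width * cos \<psi>) * (cos (\<theta> + pi / 3) + cos (\<theta> + 2 * pi / 3)))"
      by (simp add: T_def boundary_point_def det2_pt algebra_simps)
    also have "\<dots> = half_width * (cos \<psi> * (semiaxis * (sqrt 3 * cos \<theta>) - shear \<theta> * (sqrt 3 * sin \<theta>))
        + (semiaxis * sin \<psi> + shear \<psi> * cos \<psi>) * (sqrt 3 * sin \<theta>))"
      unfolding upper_later_thirds[OF \<theta>] upper_first_third[OF that]
      unfolding third_turns by (simp add: field_simps)
    also have "\<dots> = half_width * sqrt 3 * (semiaxis * cos (\<psi> - \<theta>) + cos \<psi> * sin \<theta> * (shear \<psi> - shear \<theta>))"
      by (simp add: cos_diff algebra_simps)
    finally show ?thesis .
  qed
  ultimately have "half_width * sqrt 3 * (semiaxis * cos (\<phi> - \<theta>) + cos \<phi> * sin \<theta> * (shear \<phi> - shear \<theta>))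
      \<le> half_width * sqrt 3 * semiaxis" using \<theta> \<phi> by simp
  then have "semiaxis * cos (\<phi> - \<theta>) + cos \<phi> * sin \<theta> * (shear \<phi> - shear \<theta>) \<le> semiaxis"
    using half_width_pos by simp
  then show ?thesis by (simp add: algebra_simps)
qed

text \<open>The bound on the increment is of second order in \<open>\<phi> - \<theta>\<close> and holds with the two angles exchanged,
while \<open>cos \<phi> * sin \<theta>\<close> stays away from \<open>0\<close> near a given angle. Hence \<open>shear\<close> has derivative zero.\<close>

lemma shear_constant: obtains h where "\<And>\<theta>. \<theta> \<in> {0<..<pi / 3} \<Longrightarrow> shear \<theta> = h"
proof (rule constant_of_quadratic_increments)
  fix \<theta> assume \<theta>: "\<theta> \<in> {0<..<pi / 3}"
  define m where "m = sin (\<theta> / 2)"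
  have m: "0 < m" unfolding m_def using \<theta> by (intro sin_gt_zero) auto
  have one_sided: "shear \<phi> - shear \<psi> \<le> semiaxis / m * (\<phi> - \<psi>)\<^sup>2"
    if \<phi>: "\<phi> \<in> {\<theta> / 2<..<pi / 3}" and \<psi>: "\<psi> \<in> {\<theta> / 2<..<pi / 3}" for \<phi> \<psi>
  proof (cases "shear \<phi> - shear \<psi> \<le> 0")
    case True
    have "0 \<le> semiaxis / m * (\<phi> - \<psi>)\<^sup>2" using semiaxis_pos m by simp
    then show ?thesis using True by linarith
  next
    case False
    have in3: "\<phi> \<in> {0<..<pi / 3}" "\<psi> \<in> {0<..<pi / 3}" using \<phi> \<psi> \<theta> by auto
    have "m \<le> sin \<psi>" unfolding m_def using \<theta> \<psi> by (intro sin_monotone_2pi_le) auto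
    then have "1 / 2 * m \<le> cos \<phi> * sin \<psi>" using cos_gt_half[OF in3(1)] m by (intro mult_mono) auto
    then have "1 / 2 * m * (shear \<phi> - shear \<psi>) \<le> cos \<phi> * sin \<psi> * (shear \<phi> - shear \<psi>)"
      using False by (intro mult_right_mono) auto
    also have "\<dots> \<le> semiaxis * (1 - cos (\<phi> - \<psi>))" by (rule shear_increment) (fact in3)+
    also have "\<dots> \<le> semiaxis * ((\<phi> - \<psi>)\<^sup>2 / 2)"
      using semiaxis_pos one_minus_cos_le by (intro mult_left_mono) auto
    finally have "m * (shear \<phi> - shear \<psi>) \<le> semiaxis * (\<phi> - \<psi>)\<^sup>2" by simp
    then show ?thesis using m by (simp add: field_simps)
  qed
  have "\<forall>\<^sub>F \<phi> in at \<theta>. \<phi> \<in> {\<theta> / 2<..<pi / 3}"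
    using \<theta> by (intro eventually_at_in_open') auto
  then have "\<forall>\<^sub>F \<phi> in at \<theta>. \<bar>shear \<phi> - shear \<theta>\<bar> \<le> semiaxis / m * (\<phi> - \<theta>)\<^sup>2"
  proof eventually_elim
    case (elim \<phi>)
    then show ?case using one_sided[of \<phi> \<theta>] one_sided[of \<theta> \<phi>] \<theta> by (auto simp: abs_le_iff power2_commute)
  qed
  then show "\<exists>C. \<forall>\<^sub>F \<phi> in at \<theta>. \<bar>shear \<phi> - shear \<theta>\<bar> \<le> C * (\<phi> - \<theta>)\<^sup>2" by blast
qed (use that in blast)

text \<open>The two angles \<open>\<pi>/3\<close> and \<open>2\<pi>/3\<close> at which the three arcs meet are covered by continuity.\<close>

lemma upper_elliptic:
  obtains h where "\<And>\<theta>. \<theta> \<in> {0<..<pi} \<Longrightarrow> upper (half_width * cos \<theta>) = semiaxis * sin \<theta> + h * cos \<theta>"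
proof -
  obtain h where h: "\<And>\<theta>. \<theta> \<in> {0<..<pi / 3} \<Longrightarrow> shear \<theta> = h" using shear_constant by blast
  define D where "D \<theta> = upper (half_width * cos \<theta>) - (semiaxis * sin \<theta> + h * cos \<theta>)" for \<theta>
  have off: "D \<theta> = 0" if \<theta>: "\<theta> \<in> {0<..<pi}" "\<theta> \<notin> {pi / 3, 2 * pi / 3}" for \<theta>
  proof -
    have "\<theta> < pi / 3 \<or> (pi / 3 < \<theta> \<and> \<theta> < 2 * pi / 3) \<or> 2 * pi / 3 < \<theta>"
      using \<theta> by auto
    then consider "\<theta> \<in> {0<..<pi / 3}" | "\<theta> - pi / 3 \<in> {0<..<pi / 3}" | "\<theta> - 2 * pi / 3 \<in> {0<..<pi / 3}"
      using \<theta>(1) by fastforce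
    then show ?thesis
    proof cases
      case 1 then show ?thesis using upper_first_third[OF 1] h[OF 1] by (simp add: D_def)
    next
      case 2 then show ?thesis using upper_later_thirds(1)[OF 2] h[OF 2] by (simp add: D_def)
    next
      case 3 then show ?thesis using upper_later_thirds(2)[OF 3] h[OF 3] by (simp add: D_def)
    qed
  qed
  have "continuous_on {0<..<pi} D"
    unfolding D_def by (intro continuous_intros upper_cos_continuous)
  have "D \<theta> = 0" if \<theta>: "\<theta> \<in> {0<..<pi}" for \<theta>
  proof -
    have "isCont D \<theta>"
      using \<open>continuous_on {0<..<pi} D\<close> \<theta> by (simp add: continuous_on_eq_continuous_at)
    then have lim: "(D \<longlongrightarrow> D \<theta>) (at \<theta>)" by (simp add: isCont_def)
    have "open ({0<..<pi} - ({pi / 3, 2 * pi / 3} - {\<theta>}))"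
      by (intro open_Diff finite_imp_closed) auto
    then have "\<forall>\<^sub>F t in at \<theta>. t \<in> ({0<..<pi} - ({pi / 3, 2 * pi / 3} - {\<theta>})) - {\<theta>}"
      using \<theta> by (intro eventually_at_in_open) auto
    then have "\<forall>\<^sub>F t in at \<theta>. D t = 0" by eventually_elim (use off in auto)
    then have "(D \<longlongrightarrow> 0) (at \<theta>)" by (rule tendsto_eventually)
    then show ?thesis using tendsto_unique[OF _ lim] by simp
  qed
  then show ?thesis by (intro that[of h]) (simp add: D_def)
qed

end

section \<open>Polarity and ellipses\<close>

lemma zero_in_interior:
  assumes "convex_body K" "centrally_symmetric K"
  shows "0 \<in> interior K"
proof -
  obtain x where x: "x \<in> interior K" using assms(1) unfolding convex_body_def by auto
  have "(1/2) *\<^sub>R x + (1/2) *\<^sub>R (- x) \<in> interior K"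
    by (rule convexD[OF convex_interior]) (use assms x interior_uminus in \<open>auto simp: convex_body_def\<close>)
  then show ?thesis by simp
qed

lemma ball_in_interior_differences:
  assumes "0 \<in> interior K"
  obtains m where "m > 0" "ball 0 m \<subseteq> interior_differences K"
proof -
  obtain m where m: "m > 0" "ball 0 m \<subseteq> interior K"
    using assms open_contains_ball open_interior by blast
  have "ball 0 m \<subseteq> interior_differences K"
    using m(2) assms unfolding interior_differences_def by force
  then show ?thesis using that m(1) by blast
qed

lemma polar_planar_body:
  fixes K :: "(real ^ 2) set"
  assumes K: "convex_body K" "centrally_symmetric K"
  shows "symmetric_planar_body (polar_body K)"
proof
  have eq: "polar_body K = (\<Inter>y\<in>K. {x. y \<bullet> x \<le> 1})" by (auto simp: polar_body_def)
  obtain e where e: "e > 0" "cball 0 e \<subseteq> K"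
    using zero_in_interior[OF K] by (meson mem_interior_cball)
  have "bounded (polar_body K)"
  proof (rule boundedI)
    fix x assume x: "x \<in> polar_body K"
    show "norm x \<le> 1 / e"
    proof (cases "x = 0")
      case False
      have "(e / norm x) *\<^sub>R x \<in> cball 0 e" using e False by simp
      then have "(e / norm x) *\<^sub>R x \<in> K" using e by blast
      then have "((e / norm x) *\<^sub>R x) \<bullet> x \<le> 1" using x unfolding polar_body_def by blast
      then have "e * norm x \<le> 1" using False by (simp add: dot_square_norm power2_eq_square)
      then show ?thesis using e by (simp add: field_simps)
    qed (use e in simp)
  qed
  then show "compact (polar_body K)"
    unfolding compact_eq_bounded_closed eq by (auto intro!: closed_INT closed_halfspace_le)
  show "convex (polar_body K)" unfolding eq by (intro convex_INT convex_halfspace_le)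
  show "- v \<in> polar_body K" if "v \<in> polar_body K" for v using uminus_in_polar[OF K(2) that] .
  obtain R where R: "R > 0" "\<And>y. y \<in> K \<Longrightarrow> norm y \<le> R"
    using K(1) compact_imp_bounded[of K] unfolding convex_body_def bounded_pos by blast
  have "ball 0 (1 / R) \<subseteq> polar_body K"
  proof
    fix x :: "real^2" assume x: "x \<in> ball 0 (1 / R)"
    show "x \<in> polar_body K" unfolding polar_body_def
    proof (intro CollectI ballI)
      fix y assume "y \<in> K"
      have "y \<bullet> x \<le> norm y * norm x" by (rule norm_cauchy_schwarz)
      also have "\<dots> \<le> R * (1 / R)" using R x \<open>y \<in> K\<close> by (intro mult_mono) auto
      finally show "y \<bullet> x \<le> 1" using R by simp
    qed
  qed
  then show "0 \<in> interior (polar_body K)" using R(1) by (meson centre_in_ball interiorI open_ball zero_less_divide_1_iff)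
qed

lemma polar_separates:
  fixes K :: "(real ^ 'n) set"
  assumes "convex K" "closed K" "0 \<in> interior K" "x \<notin> K"
  obtains a where "a \<in> polar_body K" "1 < a \<bullet> x"
proof -
  obtain d b where ab: "d \<bullet> x < b" "\<And>y. y \<in> K \<Longrightarrow> b < d \<bullet> y"
    using separating_hyperplane_closed_point[OF assms(1,2,4)] by blast
  have b: "b < 0" using ab(2)[of 0] assms(3) interior_subset by fastforce
  show ?thesis
  proof (rule that)
    show "(1 / b) *\<^sub>R d \<in> polar_body K"
      using ab(2) b unfolding polar_body_def
      by (auto simp: divide_le_eq inner_commute less_imp_le)
    show "1 < ((1 / b) *\<^sub>R d) \<bullet> x" using ab(1) b by (simp add: less_divide_eq)
  qed
qed

lemma norm_squared_plane: "(norm v)\<^sup>2 = (v $ 1)\<^sup>2 + (v $ 2)\<^sup>2" for v :: "real ^ 2"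
  unfolding power2_norm_eq_inner by (simp add: inner_vec_def sum_2 power2_eq_square)

text \<open>The elliptic upper boundary makes the polar body a linear image of the unit disc; the adjoint
\<open>F\<close> of this linear map sends \<open>K\<close> onto the disc. A point of \<open>K\<close> has its image in the disc because
the boundary points of the polar body bound it; conversely, a point outside \<open>K\<close> is separated
from \<open>K\<close> by an element of the polar body.\<close>

lemma ellipse_of_elliptic_polar:
  fixes K :: "(real ^ 2) set"
  assumes K: "convex_body K" "centrally_symmetric K"
    and k: "0 < k"
    and elliptic: "\<And>\<theta>. \<theta> \<in> {0<..<pi} \<Longrightarrow> symmetric_planar_body.upper (polar_body K)
        (symmetric_planar_body.half_width (polar_body K) * cos \<theta>) = k * sin \<theta> + h * cos \<theta>"
  shows "is_ellipse K"
proof -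
  interpret symmetric_planar_body "polar_body K" by (rule polar_planar_body[OF K])
  define F where "F x = pt (half_width * x $ 1 + h * x $ 2) (k * x $ 2)" for x :: "real ^ 2"
  have inner_boundary: "pt (half_width * c) (k * s + h * c) \<bullet> x = c * F x $ 1 + s * F x $ 2" for c s x
    by (simp add: F_def inner_vec_def sum_2 algebra_simps)
  have F_le: "norm (F x) \<le> 1" if x: "x \<in> K" for x
  proof -
    have le: "cos \<theta> * F x $ 1 + sin \<theta> * F x $ 2 \<le> 1" if "\<theta> \<in> {0<..<pi}" "x \<in> K" for \<theta> x
    proof -
      have "pt (half_width * cos \<theta>) (k * sin \<theta> + h * cos \<theta>) \<in> polar_body K"
        using upper_in[OF abscissa_bound[of \<theta>]] elliptic[OF that(1)] by simp
      then have "pt (half_width * cos \<theta>) (k * sin \<theta> + h * cos \<theta>) \<bullet> x \<le> 1"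
        using that(2) by (simp add: polar_body_def inner_commute)
      then show ?thesis using inner_boundary by simp
    qed
    have mx: "- x \<in> K" using x K(2) unfolding centrally_symmetric_def by auto
    have Fm: "F (- x) = - F x" by (simp add: F_def vec_eq_iff forall_2)
    have closure: "cos \<theta> * F z $ 1 + sin \<theta> * F z $ 2 \<le> 1" if \<theta>: "\<theta> \<in> {0..pi}" and z: "z \<in> K" for \<theta> z
    proof -
      have "closure {0<..<pi} = {0..pi}" by simp
      moreover have "{0<..<pi} \<subseteq> {t. cos t * F z $ 1 + sin t * F z $ 2 \<le> 1}" using le z by auto
      moreover have "closed {t. cos t * F z $ 1 + sin t * F z $ 2 \<le> 1}"
        by (intro closed_Collect_le continuous_intros)
      ultimately have "{0..pi} \<subseteq> {t. cos t * F z $ 1 + sin t * F z $ 2 \<le> 1}"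
        using closure_minimal by metis
      then show ?thesis using \<theta> by auto
    qed
    define r where "r = norm (F x)"
    have r2: "(F x $ 1)\<^sup>2 + (F x $ 2)\<^sup>2 = r\<^sup>2"
      unfolding r_def norm_squared_plane ..
    show ?thesis
    proof (cases "r = 0")
      case False
      then have "(F x $ 1 / r)\<^sup>2 + (F x $ 2 / r)\<^sup>2 = 1"
        using r2 by (simp add: power_divide add_divide_distrib[symmetric])
      then obtain t where t: "0 \<le> t" "t < 2 * pi" "F x $ 1 / r = cos t" "F x $ 2 / r = sin t"
        using sincos_total_2pi[of "F x $ 1 / r" "F x $ 2 / r"] by metis
      have comp: "F x $ 1 = r * cos t" "F x $ 2 = r * sin t" using t False by (auto simp: field_simps)
      have "r = r * ((cos t)\<^sup>2 + (sin t)\<^sup>2)" by simp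
      also have "\<dots> = cos t * F x $ 1 + sin t * F x $ 2"
        unfolding comp by algebra
      also have "\<dots> \<le> 1"
      proof (cases "t \<le> pi")
        case True
        then show ?thesis using closure[of t x] t x by simp
      next
        case False
        then show ?thesis using closure[of "t - pi" "- x"] t mx by (simp add: Fm sin_diff cos_diff)
      qed
      finally show ?thesis by (simp add: r_def)
    qed (simp add: r_def)
  qed
  have le_F: "x \<in> K" if x: "norm (F x) \<le> 1" for x
  proof (rule ccontr)
    assume "x \<notin> K"
    then obtain a where a: "a \<in> polar_body K" "1 < a \<bullet> x"
      using polar_separates[of K x] K zero_in_interior[OF K] compact_imp_closed unfolding convex_body_def by blast
    \<comment> \<open>Shrinking the separating functional slightly moves it off the vertical support lines, where the upper boundary is not described.\<close>
    define t where "t = (1 + 1 / (a \<bullet> x)) / 2"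
    have t: "0 < t" "t < 1" "1 < t * (a \<bullet> x)" using a(2) by (auto simp: t_def field_simps)
    define a' where "a' = t *\<^sub>R a"
    have a'L: "a' \<in> polar_body K"
      using convexD[OF convex a(1) zero_in, of t "1 - t"] t by (simp add: a'_def)
    have "\<bar>a' $ 1\<bar> = t * \<bar>a $ 1\<bar>" using t by (simp add: a'_def abs_mult)
    also have "\<dots> < half_width"
    proof -
      have "t * \<bar>a $ 1\<bar> \<le> t * half_width" using abscissa_le_width[OF a(1)] t by simp
      also have "\<dots> < 1 * half_width" using t half_width_pos by (intro mult_strict_right_mono) auto
      finally show ?thesis by simp
    qed
    finally have "a' $ 1 \<in> {-half_width<..<half_width}" by (simp add: abs_less_iff)
    then obtain \<theta> where \<theta>: "\<theta> \<in> {0<..<pi}" "a' $ 1 = half_width * cos \<theta>"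
      unfolding abscissa_image[symmetric] by auto
    have "upper (- (half_width * cos \<theta>)) = upper (half_width * cos (pi - \<theta>))" by simp
    also have "\<dots> = k * sin \<theta> - h * cos \<theta>" using elliptic[of "pi - \<theta>"] \<theta>(1) by simp
    finally have lower: "upper (- (half_width * cos \<theta>)) = k * sin \<theta> - h * cos \<theta>" .
    have "pt (a' $ 1) (a' $ 2) \<in> polar_body K" using a'L by (simp add: pt_components)
    then have bd: "- (k * sin \<theta>) + h * cos \<theta> \<le> a' $ 2" "a' $ 2 \<le> k * sin \<theta> + h * cos \<theta>"
      unfolding mem_iff \<theta>(2) lower elliptic[OF \<theta>(1)] by auto
    define s where "s = (a' $ 2 - h * cos \<theta>) / k"
    have s: "\<bar>s\<bar> \<le> sin \<theta>" "a' $ 2 = k * s + h * cos \<theta>"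
      using bd k by (auto simp: s_def abs_le_iff field_simps)
    have "a' \<bullet> x = cos \<theta> * F x $ 1 + s * F x $ 2"
      using inner_boundary[of "cos \<theta>" s x] pt_components[of a'] \<theta>(2) s(2) by simp
    also have "\<dots> = pt (cos \<theta>) s \<bullet> F x" by (simp add: inner_vec_def sum_2)
    also have "\<dots> \<le> norm (pt (cos \<theta>) s) * norm (F x)" by (rule norm_cauchy_schwarz)
    also have "\<dots> \<le> 1 * 1"
    proof (intro mult_mono)
      have "(norm (pt (cos \<theta>) s))\<^sup>2 = (cos \<theta>)\<^sup>2 + s\<^sup>2"
        unfolding norm_squared_plane by simp
      also have "\<dots> \<le> (cos \<theta>)\<^sup>2 + (sin \<theta>)\<^sup>2"
        using power_mono[OF s(1) abs_ge_zero, of 2] by (intro add_left_mono) simp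
      finally show "norm (pt (cos \<theta>) s) \<le> 1" by (simp add: abs_square_le_1[of "norm _", simplified])
    qed (use x in auto)
    finally show False using t(3) by (simp add: a'_def)
  qed
  define A :: "real^2^2" where
    "A = vector [vector [1 / half_width, - h / (half_width * k)], vector [0, 1 / k]]"
  have A: "A *v y = pt (y $ 1 / half_width - h * y $ 2 / (half_width * k)) (y $ 2 / k)" for y
    by (simp add: A_def matrix_vector_mult_def vec_eq_iff forall_2 sum_2)
  have FA: "F (A *v y) = y" for y
    using half_width_pos k by (simp add: A F_def vec_eq_iff forall_2 field_simps)
  have AF: "A *v F x = x" for x
    using half_width_pos k by (simp add: A F_def vec_eq_iff forall_2 field_simps)
  have "det A \<noteq> 0" using half_width_pos k by (simp add: A_def det_2)
  moreover have "K = (\<lambda>x. 0 + A *v x) ` cball 0 1"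
  proof
    show "K \<subseteq> (\<lambda>x. 0 + A *v x) ` cball 0 1"
    proof
      fix x assume "x \<in> K"
      then show "x \<in> (\<lambda>x. 0 + A *v x) ` cball 0 1" using F_le AF by (intro image_eqI[of _ _ "F x"]) auto
    qed
    show "(\<lambda>x. 0 + A *v x) ` cball 0 1 \<subseteq> K"
      using le_F FA by auto
  qed
  ultimately show ?thesis unfolding is_ellipse_def invertible_det_nz by blast
qed

section \<open>The density bound and its equality case\<close>

lemma packing_from_heavy_hexagon:
  fixes K :: "(real ^ 2) set"
  assumes K: "convex_body K" "centrally_symmetric K"
    and abc: "a \<in> polar_body K" "b \<in> polar_body K" "c \<in> polar_body K"
    and S: "S = det2 a b + det2 b c + det2 a c" "0 < S"
  shows "measure lebesgue K * S / 9 \<le> lattice_packing_density K"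
    and "lattice_packing_density K = measure lebesgue K * S / 9 \<Longrightarrow>
      det2 a b = det2 b c \<and> det2 b c = det2 a c"
    and "\<exists>A :: real^2^2. invertible A \<and> is_packing (lattice_of A) K \<and>
      lattice_packing_density K = measure lebesgue K / \<bar>det A\<bar>"
proof -
  obtain m where m: "m > 0" "ball 0 m \<subseteq> interior_differences K"
    using ball_in_interior_differences[OF zero_in_interior[OF K]] .
  obtain A :: "real ^ 2 ^ 2" where A: "invertible A" "is_packing (lattice_of A) K"
    "\<bar>det A\<bar> \<le> 9 / S" "\<bar>det A\<bar> = 9 / S \<Longrightarrow> det2 a b = det2 b c \<and> det2 b c = det2 a c"
    using packing_from_polar_points[OF K(2) abc S] by blast
  note dens = lattice_packing_density_attained[OF m A(1,2)]
  have d: "0 < \<bar>det A\<bar>" using A(1) by (simp add: invertible_det_nz)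
  have vol: "0 < measure lebesgue K"
    using measure_pos_of_interior[OF zero_in_interior[OF K]] K by (simp add: convex_body_def)
  have le: "measure lebesgue K * S / 9 \<le> measure lebesgue K / \<bar>det A\<bar>"
    using A(3) d S(2) vol by (simp add: field_simps)
  then show "measure lebesgue K * S / 9 \<le> lattice_packing_density K" using dens(2) by linarith
  show "det2 a b = det2 b c \<and> det2 b c = det2 a c"
    if "lattice_packing_density K = measure lebesgue K * S / 9"
  proof (rule A(4))
    have "measure lebesgue K * S / 9 = measure lebesgue K / \<bar>det A\<bar>" using that le dens(2) by linarith
    then show "\<bar>det A\<bar> = 9 / S" using d S(2) vol by (simp add: field_simps)
  qed
  show "\<exists>A :: real^2^2. invertible A \<and> is_packing (lattice_of A) K \<and>
      lattice_packing_density K = measure lebesgue K / \<bar>det A\<bar>" by (rule dens(1))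
qed

text \<open>In the coordinates in which the ellipse is a unit disc, the point farthest from the origin
is at distance \<open>norm d + 1\<close> for centre \<open>d\<close>. By symmetry its negative belongs to the disc too, which is impossible unless \<open>d = 0\<close>.\<close>

lemma symmetric_ellipse_centred:
  fixes K :: "(real ^ 2) set"
  assumes "is_ellipse K" "centrally_symmetric K"
  obtains A B :: "real ^ 2 ^ 2" where "A ** B = mat 1" "B ** A = mat 1" "K = (\<lambda>x. A *v x) ` cball 0 1"
proof -
  obtain A :: "real ^ 2 ^ 2" and c where A: "invertible A" "K = (\<lambda>x. c + A *v x) ` cball 0 1"
    using assms(1) unfolding is_ellipse_def by blast
  obtain B where B: "A ** B = mat 1" "B ** A = mat 1" using A(1) unfolding invertible_def by blast
  have BA: "B *v (A *v x) = x" for x by (simp add: matrix_vector_mul_assoc B)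
  define d where "d = B *v c"
  have c: "c = A *v d" by (simp add: d_def matrix_vector_mul_assoc B)
  have "c = 0"
  proof (rule ccontr)
    assume "c \<noteq> 0"
    then have d0: "d \<noteq> 0" using c by auto
    define u where "u = (1 / norm d) *\<^sub>R d"
    have "u \<in> cball 0 1" using d0 by (simp add: u_def)
    then have "c + A *v u \<in> K" using A(2) by blast
    then have "- (c + A *v u) \<in> K" using assms(2) unfolding centrally_symmetric_def by blast
    then obtain v where v: "v \<in> cball 0 1" "- (c + A *v u) = c + A *v v" using A(2) by blast
    have "A *v v = - (c + A *v u) - c" unfolding v(2) by simp
    also have "\<dots> = A *v (- (2 *\<^sub>R d + u))"
      unfolding c matrix_vector_mul_linear[THEN linear_neg] scaleR_2 matrix_vector_right_distrib by simp
    finally have "A *v v = A *v (- (2 *\<^sub>R d + u))" .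
    then have "v = - (2 *\<^sub>R d + u)" using BA by metis
    also have "\<dots> = - ((2 + 1 / norm d) *\<^sub>R d)" by (simp add: u_def scaleR_add_left)
    finally have "norm v = \<bar>2 + 1 / norm d\<bar> * norm d" by simp
    also have "\<dots> = 2 * norm d + 1" using d0 by (simp add: field_simps)
    finally show False using v(1) d0 by simp
  qed
  then show ?thesis using that B A(2) by simp
qed

lemma polar_of_linear_ball:
  fixes A B :: "real ^ 'n ^ 'n"
  assumes "A ** B = mat 1" "B ** A = mat 1"
  shows "polar_body ((\<lambda>x. A *v x) ` cball 0 1) = (\<lambda>x. transpose B *v x) ` cball 0 1"
proof -
  have adj: "(A *v u) \<bullet> x = u \<bullet> (transpose A *v x)" for u x
    by (simp add: dot_lmul_matrix[symmetric] transpose_matrix_vector inner_commute)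
  have tt: "transpose A *v (transpose B *v x) = x" "transpose B *v (transpose A *v x) = x" for x
    using assms by (metis matrix_transpose_mul matrix_vector_mul_assoc matrix_vector_mul_lid transpose_mat)+
  have ball: "(\<forall>u\<in>cball 0 1. u \<bullet> z \<le> 1) \<longleftrightarrow> norm z \<le> 1" for z :: "real^'n"
  proof
    assume H: "\<forall>u\<in>cball 0 1. u \<bullet> z \<le> 1"
    show "norm z \<le> 1"
    proof (cases "z = 0")
      case False
      then have "((1 / norm z) *\<^sub>R z) \<bullet> z \<le> 1" using H by (auto simp del: inner_scaleR_left)
      then show ?thesis using False by (simp add: dot_square_norm power2_eq_square)
    qed simp
  next
    assume z: "norm z \<le> 1"
    show "\<forall>u\<in>cball 0 1. u \<bullet> z \<le> 1"
    proof
      fix u :: "real^'n" assume "u \<in> cball 0 1"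
      then have "norm u * norm z \<le> 1 * 1" using z by (intro mult_mono) auto
      then show "u \<bullet> z \<le> 1" using norm_cauchy_schwarz[of u z] by linarith
    qed
  qed
  have "x \<in> polar_body ((\<lambda>x. A *v x) ` cball 0 1) \<longleftrightarrow> norm (transpose A *v x) \<le> 1" for x
    using ball[of "transpose A *v x"] by (simp add: polar_body_def adj)
  then show ?thesis using tt by (auto intro!: image_eqI[of _ _ "transpose A *v _"])
qed

lemma measure_linear_unit_disc:
  fixes A :: "real ^ 2 ^ 2"
  shows "measure lebesgue ((\<lambda>x. A *v x) ` cball 0 1) = \<bar>det A\<bar> * pi"
proof -
  have "measure lebesgue (cball (0::real^2) 1) = pi"
    by (simp add: content_cball unit_ball_vol_2)
  then show ?thesis
    using measure_linear_image[of "\<lambda>x. A *v x" "cball 0 1"] by simp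
qed

text \<open>Passing to the coordinates in which the ellipse is the unit disc, packing means that nonzero lattice
vectors have length at least \<open>2\<close>, and Hermite's bound applies.\<close>

lemma ellipse_density_le:
  fixes A B :: "real ^ 2 ^ 2"
  assumes AB: "A ** B = mat 1" "B ** A = mat 1"
    and P: "invertible P" "is_packing (lattice_of P) ((\<lambda>x. A *v x) ` cball 0 1)"
  shows "2 * sqrt 3 * \<bar>det A\<bar> \<le> \<bar>det P\<bar>"
proof -
  let ?K = "(\<lambda>x. A *v x) ` cball 0 1"
  have dets: "det A * det B = 1" using AB(1) det_mul[of A B] by simp
  have inj: "inj (\<lambda>x. A *v x)" by (rule injI) (metis AB(2) matrix_vector_mul_assoc matrix_vector_mul_lid)
  have int: "interior ?K = (\<lambda>x. A *v x) ` ball 0 1"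
    by (subst interior_injective_linear_image[OF _ inj]) auto
  have short: "2 \<le> norm v" if v: "v \<in> lattice_of (B ** P)" "v \<noteq> 0" for v
  proof (rule ccontr)
    assume "\<not> 2 \<le> norm v"
    then have half: "(1/2) *\<^sub>R v \<in> ball 0 1" "- ((1/2) *\<^sub>R v) \<in> ball 0 1" by auto
    obtain z where z: "v = (B ** P) *v z" "\<forall>i. z $ i \<in> \<int>" using v(1) by (auto simp: lattice_of_def)
    have Av: "A *v v = P *v z" using AB(1) by (simp add: z(1) matrix_vector_mul_assoc matrix_mul_assoc)
    have "A *v v = A *v ((1/2) *\<^sub>R v) - A *v (- ((1/2) *\<^sub>R v))"
      by (simp add: matrix_vector_mult_diff_distrib[symmetric] scaleR_add_left[symmetric])
    then have "A *v v \<in> interior_differences ?K"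
      unfolding interior_differences_def int using half by blast
    moreover have "A *v v \<in> lattice_of P" using Av z(2) by (auto simp: lattice_of_def)
    moreover have "A *v v \<noteq> 0" using inj v(2) by (metis injD matrix_vector_mult_0_right)
    ultimately show False using P(2) unfolding is_packing_lattice_iff by blast
  qed
  have "det (B ** P) \<noteq> 0" using dets P(1) by (auto simp: det_mul invertible_det_nz)
  from det_squared_ge_of_min_norm[OF _ short this]
  have "12 \<le> (det (B ** P))\<^sup>2" by simp
  then have "sqrt 12 \<le> \<bar>det (B ** P)\<bar>" using real_sqrt_le_mono by fastforce
  moreover have "sqrt 12 = 2 * sqrt 3" using real_sqrt_mult[of 4 3] by simp
  ultimately have "2 * sqrt 3 \<le> \<bar>det B\<bar> * \<bar>det P\<bar>" by (simp add: det_mul abs_mult)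
  then have "2 * sqrt 3 * \<bar>det A\<bar> \<le> \<bar>det B\<bar> * \<bar>det P\<bar> * \<bar>det A\<bar>" by (intro mult_right_mono) auto
  also have "\<dots> = \<bar>det A * det B\<bar> * \<bar>det P\<bar>" by (simp add: abs_mult)
  finally show ?thesis using dets by simp
qed

theorem corollary2p1:
  fixes K :: "(real ^ 2) set"
  assumes "convex_body K" and "centrally_symmetric K"
  shows "lattice_packing_density K \<ge>
           1 / (2 * pi * sqrt 3) * measure lebesgue K * measure lebesgue (polar_body K)
       \<and> (lattice_packing_density K =
            1 / (2 * pi * sqrt 3) * measure lebesgue K * measure lebesgue (polar_body K)
          \<longleftrightarrow> is_ellipse K)"
proof -
  interpret symmetric_planar_body "polar_body K" by (rule polar_planar_body[OF assms])
  let ?V = "measure lebesgue K" and ?M = mean_hexagon_area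
  have rhs: "1 / (2 * pi * sqrt 3) * ?V * measure lebesgue (polar_body K) = ?V * ?M / 9"
  proof -
    have "1 / (2 * pi * sqrt 3) = (1 / sqrt 3) / (2 * pi)" by simp
    also have "1 / sqrt 3 = sqrt 3 / 3" by (simp add: divide_simps)
    finally show ?thesis by (simp add: mean_hexagon_area_def)
  qed
  note packing = packing_from_heavy_hexagon[OF assms]
  have V: "0 \<le> ?V" by simp
  have "pi / 6 \<in> {0<..<pi / 3}" by simp
  then obtain \<theta> where \<theta>: "?M \<le> hexagon_area \<theta>"
    using hexagon_area_dichotomy by (metis order_refl less_imp_le)
  have pos: "0 < hexagon_area \<theta>" using \<theta> mean_hexagon_area_pos by linarith
  note hex = packing[OF boundary_point_in boundary_point_in boundary_point_in hexagon_area_def pos]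
  have "?V * ?M / 9 \<le> ?V * hexagon_area \<theta> / 9" using \<theta> V by (simp add: mult_left_mono)
  then have bound: "?V * ?M / 9 \<le> lattice_packing_density K" using hex(1) by linarith
  have "is_ellipse K" if eq: "lattice_packing_density K = ?V * ?M / 9"
  proof -
    have Vpos: "0 < ?V"
      using measure_pos_of_interior[OF zero_in_interior[OF assms]] assms by (simp add: convex_body_def)
    interpret extremal_planar_body "polar_body K"
    proof
      fix a b c assume abc: "a \<in> polar_body K" "b \<in> polar_body K" "c \<in> polar_body K"
      show "det2 a b + det2 b c + det2 a c \<le> ?M"
      proof (rule ccontr)
        assume "\<not> ?thesis"
        then have gt: "?M < det2 a b + det2 b c + det2 a c" by simp
        then have "?V * (det2 a b + det2 b c + det2 a c) / 9 \<le> ?V * ?M / 9"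
          using packing(1)[OF abc refl] mean_hexagon_area_pos eq by simp
        then show False using gt Vpos by simp
      qed
      show "det2 a b = det2 b c \<and> det2 b c = det2 a c"
        if "det2 a b + det2 b c + det2 a c = ?M"
        using packing(2)[OF abc that[symmetric] mean_hexagon_area_pos eq] .
    qed
    obtain h where "\<And>\<theta>. \<theta> \<in> {0<..<pi} \<Longrightarrow> upper (half_width * cos \<theta>) = semiaxis * sin \<theta> + h * cos \<theta>"
      using upper_elliptic by blast
    then show ?thesis by (rule ellipse_of_elliptic_polar[OF assms semiaxis_pos])
  qed
  moreover have "lattice_packing_density K = ?V * ?M / 9" if ell: "is_ellipse K"
  proof -
    obtain A B :: "real^2^2" where AB: "A ** B = mat 1" "B ** A = mat 1" "K = (\<lambda>x. A *v x) ` cball 0 1"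
      using symmetric_ellipse_centred[OF ell assms(2)] .
    obtain P :: "real^2^2" where P: "invertible P" "is_packing (lattice_of P) K"
      "lattice_packing_density K = ?V / \<bar>det P\<bar>" using hex(3) by blast
    have dets: "\<bar>det A\<bar> * \<bar>det B\<bar> = 1" using AB(1) det_mul[of A B] by (simp add: abs_mult[symmetric])
    have area: "?V = \<bar>det A\<bar> * pi" unfolding AB(3) by (rule measure_linear_unit_disc)
    have polar: "measure lebesgue (polar_body K) = \<bar>det B\<bar> * pi"
      unfolding AB(3) polar_of_linear_ball[OF AB(1,2)] measure_linear_unit_disc by simp
    \<comment> \<open>For an ellipse the inequality already proved is matched by the upper bound on the density.\<close>
    have "2 * sqrt 3 * \<bar>det A\<bar> \<le> \<bar>det P\<bar>" using ellipse_density_le[OF AB(1,2)] P AB(3) by simp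
    moreover have "0 < \<bar>det P\<bar>" "0 < \<bar>det A\<bar>" using P(1) dets by (auto simp: invertible_det_nz)
    ultimately have "?V / \<bar>det P\<bar> \<le> pi / (2 * sqrt 3)" by (simp add: area field_simps)
    also have "\<dots> = 1 / (2 * pi * sqrt 3) * ?V * measure lebesgue (polar_body K)"
    proof -
      have "?V * measure lebesgue (polar_body K) = (\<bar>det A\<bar> * \<bar>det B\<bar>) * pi * pi"
        unfolding area polar by simp
      then have "?V * measure lebesgue (polar_body K) = pi * pi" unfolding dets by simp
      then have "1 / (2 * pi * sqrt 3) * (?V * measure lebesgue (polar_body K)) = pi / (2 * sqrt 3)" by simp
      then show ?thesis by simp
    qed
    finally show ?thesis using bound P(3) rhs by simp
  qed
  ultimately show ?thesis using bound unfolding rhs by blast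
qed

end
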